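(* Let $U$ be a unitary operator and $C$ a conjugation on a separable complex Hilbert space $\mathcal{H}$. Suppose $\mu_\infty,\mu_1,\mu_2,\dots$ are mutually singular finite positive Borel measures on $\mathbb{T}$, $\mathcal{H}_k$ Hilbert spaces with $\dim\mathcal{H}_k = k$ ($k=\infty,1,2,\dots$), and $\mathcal{I}:\mathcal{H}\to\mathbf{L}^2_{\mathcal{H}} := \bigoplus_i\mathscr{L}^2(\mu_i,\mathcal{H}_i)$ is an isometric isomorphism with $\mathcal{I}U\mathcal{I}^* = \bigoplus_i\mathbf{M}_\xi^{(i)}$, where $\mathbf{M}_\xi^{(i)}$ is multiplication by $\xi$ on $\mathscr{L}^2(\mu_i,\mathcal{H}_i)$. Assume $\mu_i^c\ll\mu_i$ for all $i$, and let $h_i = d\mu_i^c/d\mu_i$. Then the following are equivalent: (a) $CUC = U$; (b) for each $i$ there is a conjugation $\mathbf{C}^i$ on $\mathscr{L}^2(\mu_i,\mathcal{H}_i)$ with $\mathbf{C}^i\mathbf{M}_\xi^{(i)}\mathbf{C}^i = \mathbf{M}_\xi^{(i)}$, such that $C = \mathcal{I}^*\big(\bigoplus_i\mathbf{C}^i\big)\mathcal{I}$; (c) for each $i$ and any conjugation $J^{(i)}$ on $\mathcal{H}_i$, there is $\mathbf{U}^{(i)}\in\mathscr{L}^\infty(\mu_i,\mathcal{B}(\mathcal{H}_i))$ with $\mathbf{U}^{(i)}(\xi)$ unitary and $J^{(i)}\mathbf{U}^{(i)}(\xi)J^{(i)} = \mathbf{U}^{(i)}(\overline{\xi})^*$ for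 $\mu_i$-a.e. $\xi$, such that $$C = \mathcal{I}^*\Big(\bigoplus_i\mathbf{M}_{\mathbf{U}^{(i)}}\mathbf{J}^{\#(i)}\Big)\mathcal{I} = \mathcal{I}^*\Big(\bigoplus_i\mathbf{M}_{\mathbf{U}^{(i)}}\Big)\Big(\bigoplus_i\mathbf{J}^{\#(i)}\Big)\mathcal{I},$$ where $(\mathbf{J}^{\#(i)}\mathbf{f})(\xi) = h_i(\xi)^{1/2}J^{(i)}(\mathbf{f}(\overline{\xi}))$ on $\mathscr{L}^2(\mu_i,\mathcal{H}_i)$.
   Context: A conjugation is an antilinear, isometric map $C$ with $C^2=I$. $\mu^c(\Omega) := \mu(\{\overline{\xi}:\xi\in\Omega\})$. $\mathscr{L}^2(\mu,\mathcal{K})$ is the Hilbert space of $\mathcal{K}$-valued $\mu$-square-integrable functions on $\mathbb{T}$, $\mathscr{L}^\infty(\mu,\mathcal{B}(\mathcal{K}))$ the $\mu$-essentially bounded $\mathcal{B}(\mathcal{K})$-valued functions, and $(\mathbf{M}_{\mathbf{U}}\mathbf{f})(\xi) = \mathbf{U}(\xi)\mathbf{f}(\xi)$. *)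

theory Defs
  imports "HOL-Analysis.Analysis"
begin

class complex_inner = ab_group_add +
  fixes scaleC :: "complex \<Rightarrow> 'a \<Rightarrow> 'a" (infixr \<open>*\<^sub>C\<close> 75)
    and cinner :: "'a \<Rightarrow> 'a \<Rightarrow> complex"
  assumes scaleC_add_right: "a *\<^sub>C (x + y) = a *\<^sub>C x + a *\<^sub>C y"
    and scaleC_add_left: "(a + b) *\<^sub>C x = a *\<^sub>C x + b *\<^sub>C x"
    and scaleC_scaleC: "a *\<^sub>C (b *\<^sub>C x) = (a * b) *\<^sub>C x"
    and scaleC_one: "1 *\<^sub>C x = x"
    and cinner_commute: "cinner x y = cnj (cinner y x)"
    and cinner_add_right: "cinner x (y + z) = cinner x y + cinner x z"
    and cinner_scaleC_right: "cinner x (a *\<^sub>C y) = a * cinner x y"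
    and cinner_nonneg: "0 \<le> Re (cinner x x)"
    and cinner_eq_zero: "cinner x x = 0 \<longleftrightarrow> x = 0"

definition cnorm :: "'a::complex_inner \<Rightarrow> real" where
  "cnorm x = sqrt (Re (cinner x x))"

class chilbert = complex_inner +
  assumes cauchy_converges:
    "(\<forall>e>0. \<exists>N::nat. \<forall>m\<ge>N. \<forall>n\<ge>N. sqrt (Re (cinner (X m - X n) (X m - X n))) < e) \<Longrightarrow>
     \<exists>l. \<forall>e>0. \<exists>N::nat. \<forall>n\<ge>N. sqrt (Re (cinner (X n - l) (X n - l))) < e"

definition separable_H :: "'a::complex_inner itself \<Rightarrow> bool" where
  "separable_H _ \<longleftrightarrow> (\<exists>D::'a set. countable D \<and> (\<forall>x. \<forall>e>0. \<exists>d\<in>D. cnorm (x - d) < e))"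

definition unitary_op :: "('a::complex_inner \<Rightarrow> 'a) \<Rightarrow> bool" where
  "unitary_op U \<longleftrightarrow> (\<forall>x y. U (x + y) = U x + U y) \<and> (\<forall>c x. U (c *\<^sub>C x) = c *\<^sub>C U x)
     \<and> (\<forall>x. cnorm (U x) = cnorm x) \<and> surj U"

definition hconjugation :: "('a::complex_inner \<Rightarrow> 'a) \<Rightarrow> bool" where
  "hconjugation C \<longleftrightarrow> (\<forall>x y. C (x + y) = C x + C y) \<and> (\<forall>c x. C (c *\<^sub>C x) = cnj c *\<^sub>C C x)
     \<and> (\<forall>x. cnorm (C x) = cnorm x) \<and> (\<forall>x. C (C x) = x)"

definition hclosed_subspace :: "'a::complex_inner set \<Rightarrow> bool" where
  "hclosed_subspace S \<longleftrightarrow> 0 \<in> S \<and> (\<forall>x\<in>S. \<forall>y\<in>S. x + y \<in> S) \<and> (\<forall>c. \<forall>x\<in>S. c *\<^sub>C x \<in> S)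
     \<and> (\<forall>X l. (\<forall>n. X n \<in> S) \<and> (\<forall>e>0. \<exists>N::nat. \<forall>n\<ge>N. cnorm (X n - l) < e) \<longrightarrow> l \<in> S)"

definition horthonormal :: "'a::complex_inner set \<Rightarrow> bool" where
  "horthonormal B \<longleftrightarrow> (\<forall>b\<in>B. cinner b b = 1) \<and> (\<forall>b\<in>B. \<forall>c\<in>B. b \<noteq> c \<longrightarrow> cinner b c = 0)"

definition hcspan :: "'a::complex_inner set \<Rightarrow> 'a set" where
  "hcspan B = {(\<Sum>b\<in>F. c b *\<^sub>C b) | F c. finite F \<and> F \<subseteq> B}"

definition hilbert_dim :: "'a::complex_inner set \<Rightarrow> enat \<Rightarrow> bool" where
  "hilbert_dim S k \<longleftrightarrow> (\<exists>B. B \<subseteq> S \<and> horthonormal B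
      \<and> (\<forall>x\<in>S. \<forall>e>0. \<exists>y\<in>hcspan B. cnorm (x - y) < e)
      \<and> (if k = \<infinity> then infinite B \<and> countable B else finite B \<and> enat (card B) = k))"

text \<open>The multiplicity index: we index the family (\<infinity>, 1, 2, ...) by nat, with 0
standing for \<infinity>.\<close>
definition dimidx :: "nat \<Rightarrow> enat" where
  "dimidx n = (if n = 0 then \<infinity> else enat n)"

definition hlinear_on :: "'a::complex_inner set \<Rightarrow> ('a \<Rightarrow> 'a) \<Rightarrow> bool" where
  "hlinear_on S A \<longleftrightarrow> (\<forall>x\<in>S. A x \<in> S) \<and> (\<forall>x\<in>S. \<forall>y\<in>S. A (x + y) = A x + A y)
     \<and> (\<forall>c. \<forall>x\<in>S. A (c *\<^sub>C x) = c *\<^sub>C A x)"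

definition hbounded_on :: "'a::complex_inner set \<Rightarrow> ('a \<Rightarrow> 'a) \<Rightarrow> bool" where
  "hbounded_on S A \<longleftrightarrow> hlinear_on S A \<and> (\<exists>B. \<forall>x\<in>S. cnorm (A x) \<le> B * cnorm x)"

definition hunitary_on :: "'a::complex_inner set \<Rightarrow> ('a \<Rightarrow> 'a) \<Rightarrow> bool" where
  "hunitary_on S A \<longleftrightarrow> hlinear_on S A \<and> (\<forall>x\<in>S. cnorm (A x) = cnorm x) \<and> A ` S = S"

definition conjugation_on :: "'a::complex_inner set \<Rightarrow> ('a \<Rightarrow> 'a) \<Rightarrow> bool" where
  "conjugation_on S J \<longleftrightarrow> (\<forall>x\<in>S. J x \<in> S) \<and> (\<forall>x\<in>S. \<forall>y\<in>S. J (x + y) = J x + J y)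
     \<and> (\<forall>c. \<forall>x\<in>S. J (c *\<^sub>C x) = cnj c *\<^sub>C J x)
     \<and> (\<forall>x\<in>S. cnorm (J x) = cnorm x) \<and> (\<forall>x\<in>S. J (J x) = x)"

definition circle_borel :: "complex measure \<Rightarrow> bool" where
  "circle_borel M \<longleftrightarrow> sets M = sets (restrict_space borel (sphere (0::complex) 1))"

definition hmutually_singular :: "'a measure \<Rightarrow> 'a measure \<Rightarrow> bool" where
  "hmutually_singular M N \<longleftrightarrow> (\<exists>A\<in>sets M. emeasure M A = 0 \<and> emeasure N (space N - A) = 0)"

definition conj_measure :: "complex measure \<Rightarrow> complex measure" where
  "conj_measure M = distr M M cnj"

definition hdens :: "complex measure \<Rightarrow> complex \<Rightarrow> ennreal" where
  "hdens M = RN_deriv M (conj_measure M)"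

section \<open>Vector-valued L^2 spaces (elements are representatives; equality is a.e.)\<close>

definition memL2 :: "complex measure \<Rightarrow> 'a::complex_inner set \<Rightarrow> (complex \<Rightarrow> 'a) \<Rightarrow> bool" where
  "memL2 M S f \<longleftrightarrow> (\<forall>v. (\<lambda>\<xi>. cinner v (f \<xi>)) \<in> borel_measurable M)
     \<and> (\<forall>\<xi>\<in>space M. f \<xi> \<in> S)
     \<and> (\<integral>\<^sup>+\<xi>. ennreal ((cnorm (f \<xi>))\<^sup>2) \<partial>M) < \<infinity>"

definition memL2H :: "(nat \<Rightarrow> complex measure) \<Rightarrow> (nat \<Rightarrow> 'a::complex_inner set)
    \<Rightarrow> (nat \<Rightarrow> complex \<Rightarrow> 'a) \<Rightarrow> bool" where
  "memL2H \<mu> E F \<longleftrightarrow> (\<forall>n. memL2 (\<mu> n) (E n) (F n))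
     \<and> (\<Sum>n. \<integral>\<^sup>+\<xi>. ennreal ((cnorm (F n \<xi>))\<^sup>2) \<partial>(\<mu> n)) < \<infinity>"

definition normsqL2H :: "(nat \<Rightarrow> complex measure) \<Rightarrow> (nat \<Rightarrow> complex \<Rightarrow> 'a::complex_inner) \<Rightarrow> ennreal" where
  "normsqL2H \<mu> F = (\<Sum>n. \<integral>\<^sup>+\<xi>. ennreal ((cnorm (F n \<xi>))\<^sup>2) \<partial>(\<mu> n))"

definition aeqH :: "(nat \<Rightarrow> complex measure) \<Rightarrow> (nat \<Rightarrow> complex \<Rightarrow> 'a) \<Rightarrow> (nat \<Rightarrow> complex \<Rightarrow> 'a) \<Rightarrow> bool" where
  "aeqH \<mu> F G \<longleftrightarrow> (\<forall>n. AE \<xi> in \<mu> n. F n \<xi> = G n \<xi>)"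

definition isometric_iso :: "(nat \<Rightarrow> complex measure) \<Rightarrow> (nat \<Rightarrow> 'a::complex_inner set)
    \<Rightarrow> ('h::complex_inner \<Rightarrow> nat \<Rightarrow> complex \<Rightarrow> 'a) \<Rightarrow> bool" where
  "isometric_iso \<mu> E I \<longleftrightarrow> (\<forall>x. memL2H \<mu> E (I x))
     \<and> (\<forall>x y. aeqH \<mu> (I (x + y)) (\<lambda>n \<xi>. I x n \<xi> + I y n \<xi>))
     \<and> (\<forall>c x. aeqH \<mu> (I (c *\<^sub>C x)) (\<lambda>n \<xi>. c *\<^sub>C I x n \<xi>))
     \<and> (\<forall>x. normsqL2H \<mu> (I x) = ennreal ((cnorm x)\<^sup>2))
     \<and> (\<forall>F. memL2H \<mu> E F \<longrightarrow> (\<exists>x. aeqH \<mu> (I x) F))"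

definition conjugation_L2 :: "complex measure \<Rightarrow> 'a::complex_inner set
    \<Rightarrow> ((complex \<Rightarrow> 'a) \<Rightarrow> (complex \<Rightarrow> 'a)) \<Rightarrow> bool" where
  "conjugation_L2 M S T \<longleftrightarrow>
     (\<forall>f. memL2 M S f \<longrightarrow> memL2 M S (T f))
   \<and> (\<forall>f g. memL2 M S f \<and> memL2 M S g \<and> (AE \<xi> in M. f \<xi> = g \<xi>) \<longrightarrow> (AE \<xi> in M. T f \<xi> = T g \<xi>))
   \<and> (\<forall>f g. memL2 M S f \<and> memL2 M S g \<longrightarrow> (AE \<xi> in M. T (\<lambda>\<eta>. f \<eta> + g \<eta>) \<xi> = T f \<xi> + T g \<xi>))
   \<and> (\<forall>c f. memL2 M S f \<longrightarrow> (AE \<xi> in M. T (\<lambda>\<eta>. c *\<^sub>C f \<eta>) \<xi> = cnj c *\<^sub>C T f \<xi>))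
   \<and> (\<forall>f. memL2 M S f \<longrightarrow> (\<integral>\<^sup>+\<xi>. ennreal ((cnorm (T f \<xi>))\<^sup>2) \<partial>M) = (\<integral>\<^sup>+\<xi>. ennreal ((cnorm (f \<xi>))\<^sup>2) \<partial>M))
   \<and> (\<forall>f. memL2 M S f \<longrightarrow> (AE \<xi> in M. T (T f) \<xi> = f \<xi>))"

definition mult_xi :: "(complex \<Rightarrow> 'a::complex_inner) \<Rightarrow> complex \<Rightarrow> 'a" where
  "mult_xi f = (\<lambda>\<xi>. \<xi> *\<^sub>C f \<xi>)"

definition Linf_op :: "complex measure \<Rightarrow> 'a::complex_inner set \<Rightarrow> (complex \<Rightarrow> 'a \<Rightarrow> 'a) \<Rightarrow> bool" where
  "Linf_op M S W \<longleftrightarrow> (\<forall>v w. (\<lambda>\<xi>. cinner v (W \<xi> w)) \<in> borel_measurable M)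
     \<and> (AE \<xi> in M. hbounded_on S (W \<xi>))
     \<and> (\<exists>B. AE \<xi> in M. \<forall>x\<in>S. cnorm (W \<xi> x) \<le> B * cnorm x)"

definition Jsharp :: "complex measure \<Rightarrow> ('a::complex_inner \<Rightarrow> 'a) \<Rightarrow> (complex \<Rightarrow> 'a) \<Rightarrow> complex \<Rightarrow> 'a" where
  "Jsharp M J f = (\<lambda>\<xi>. complex_of_real (sqrt (enn2real (hdens M \<xi>))) *\<^sub>C J (f (cnj \<xi>)))"

end

theory Submission
  imports Defs
begin

text \<open>
  Condition (a) says that C commutes with U. Then x + c U^k x and its image under C have the same
  norm for all c and k, which determines the Fourier coefficients of the spectral measure
  A \<mapsto> \<Sum>n. \<integral>_A |I x n|^2 d\<mu>_n: the spectral measures of x and C x are complex conjugate to each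
  other. Localising to disjoint supports of the \<mu>_n turns this into the pointwise identity
  |I (C x) n \<xi>|^2 = h_n(\<xi>) |I x n (cnj \<xi>)|^2 almost everywhere, which carries the whole theorem.
  Because its right-hand side vanishes with I x n, C respects the direct sum, giving (b). Polarised, it says
  that the images d_k under C of sqrt(h_n) J b_k, for an orthonormal basis b_k of E n, are almost
  everywhere orthonormal; the isometries W(\<xi>) with W(\<xi>) b_k = d_k(\<xi>) are the operators in (c), and
  C C = 1 yields W(\<xi>) J W(cnj \<xi>) J = 1, hence unitarity and the adjoint relation. Conversely the
  operators in (b) and (c) visibly commute with multiplication by \<xi>.
\<close>

section \<open>Complex Hilbert spaces\<close>

text \<open>Elements of the L^2 spaces are representatives, so every identity holds only off a null
  set that depends on the vectors involved. Two devices cope with this. Only countably many vectors,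
  a basis and its images, are treated simultaneously, and the rest is recovered by isometric
  extension. Absolute continuity makes reflections of null sets null, so that statements at
  \<open>\<xi>\<close> and at \<open>cnj \<xi>\<close> can be combined. The functions sqrt(h_n) J
  b_k are chosen because J# maps them to the constant b_k, so any W with C = W J# has to send b_k to
  their images under C. This rests on h_n(\<xi>) h_n(cnj \<xi>) = 1, which comes from C C = 1 and
  the norm identity for a constant unit vector. Testing with x + c U^k x, instead of the inner
  products of U^k x with x, keeps all measures and integrands nonnegative. The exponents k \<ge> 0
  suffice, since on the circle the negative moments of a positive measure are the conjugates of the
  positive ones.\<close>

lemma scaleC_zero_right [simp]: "a *\<^sub>C (0::'a::complex_inner) = 0"
  using scaleC_add_right[of a 0 "0::'a"] by simp

lemma scaleC_zero_left [simp]: "0 *\<^sub>C (x::'a::complex_inner) = 0"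
  using scaleC_add_left[of 0 0 x] by simp

lemma scaleC_minus_left: "(- a) *\<^sub>C (x::'a::complex_inner) = - (a *\<^sub>C x)"
  using scaleC_add_left[of "- a" a x] by (simp add: eq_neg_iff_add_eq_0)

lemma scaleC_minus_one: "(- 1) *\<^sub>C (x::'a::complex_inner) = - x"
  by (simp add: scaleC_minus_left scaleC_one)

lemma scaleC_minus_right: "a *\<^sub>C (- x::'a::complex_inner) = - (a *\<^sub>C x)"
  using scaleC_add_right[of a "- x" x] by (simp add: eq_neg_iff_add_eq_0)

lemma scaleC_diff_right: "a *\<^sub>C (x - y::'a::complex_inner) = a *\<^sub>C x - a *\<^sub>C y"
  using scaleC_add_right[of a x "- y"] by (simp add: scaleC_minus_right)

lemma scaleC_diff_left: "(a - b) *\<^sub>C (x::'a::complex_inner) = a *\<^sub>C x - b *\<^sub>C x"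
  using scaleC_add_left[of a "- b" x] by (simp add: scaleC_minus_left)

lemma scaleC_sum_right: "a *\<^sub>C (\<Sum>k\<in>F. f k::'a::complex_inner) = (\<Sum>k\<in>F. a *\<^sub>C f k)"
  by (induction F rule: infinite_finite_induct) (auto simp: scaleC_add_right)

lemma cinner_zero_right [simp]: "cinner x (0::'a::complex_inner) = 0"
  using cinner_add_right[of x 0 "0::'a"] by simp

lemma cinner_zero_left [simp]: "cinner (0::'a::complex_inner) x = 0"
  by (subst cinner_commute) simp

lemma cinner_add_left: "cinner (x + y::'a::complex_inner) z = cinner x z + cinner y z"
  by (metis cinner_add_right cinner_commute complex_cnj_add)

lemma cinner_scaleC_left: "cinner (a *\<^sub>C x::'a::complex_inner) y = cnj a * cinner x y"
  by (metis cinner_scaleC_right cinner_commute complex_cnj_mult)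

lemma cinner_minus_right: "cinner x (- y::'a::complex_inner) = - cinner x y"
  using cinner_add_right[of x y "- y"] by (simp add: eq_neg_iff_add_eq_0 add.commute)

lemma cinner_minus_left: "cinner (- x::'a::complex_inner) y = - cinner x y"
  using cinner_add_left[of x "- x" y] by (simp add: eq_neg_iff_add_eq_0 add.commute)

lemma cinner_diff_right: "cinner x (y - z::'a::complex_inner) = cinner x y - cinner x z"
  using cinner_add_right[of x y "- z"] by (simp add: cinner_minus_right)

lemma cinner_sum_right: "cinner x (\<Sum>k\<in>F. f k::'a::complex_inner) = (\<Sum>k\<in>F. cinner x (f k))"
  by (induction F rule: infinite_finite_induct) (auto simp: cinner_add_right)

lemma cinner_sum_left: "cinner (\<Sum>k\<in>F. f k::'a::complex_inner) x = (\<Sum>k\<in>F. cinner (f k) x)"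
  by (induction F rule: infinite_finite_induct) (auto simp: cinner_add_left)

lemma cnorm_ge_0 [simp]: "0 \<le> cnorm x"
  by (simp add: cnorm_def cinner_nonneg)

lemma cnorm_power2: "(cnorm x)\<^sup>2 = Re (cinner x x)"
  by (simp add: cnorm_def cinner_nonneg)

lemma cinner_self: "cinner x x = complex_of_real ((cnorm x)\<^sup>2)"
proof -
  have "Im (cinner x x) = 0"
    using cinner_commute[of x x] by (metis Reals_cnj_iff complex_is_Real_iff)
  then show ?thesis
    by (simp add: cnorm_power2 complex_eq_iff)
qed

lemma cnorm_eq_0 [simp]: "cnorm x = 0 \<longleftrightarrow> x = 0"
  using cinner_self[of x] cinner_eq_zero[of x] by auto

lemma cnorm_zero [simp]: "cnorm 0 = 0"
  by simp

lemma cnj_mult_self: "cnj a * (a * complex_of_real r) = complex_of_real ((cmod a)\<^sup>2 * r)"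
  by (simp add: complex_norm_square mult.assoc[symmetric] mult.commute[of "cnj a"] del: of_real_power)

lemma cnorm_scaleC: "cnorm (a *\<^sub>C x) = cmod a * cnorm x"
proof -
  have "cinner (a *\<^sub>C x) (a *\<^sub>C x) = complex_of_real ((cmod a)\<^sup>2 * (cnorm x)\<^sup>2)"
    unfolding cinner_scaleC_left cinner_scaleC_right cinner_self[of x]
    by (subst mult.left_commute) (rule cnj_mult_self)
  then have "(cnorm (a *\<^sub>C x))\<^sup>2 = (cmod a)\<^sup>2 * (cnorm x)\<^sup>2"
    unfolding cnorm_power2[of "a *\<^sub>C x"] by (simp only: Re_complex_of_real)
  then have "(cnorm (a *\<^sub>C x))\<^sup>2 = (cmod a * cnorm x)\<^sup>2"
    by (simp only: power_mult_distrib)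
  then show ?thesis
    by (rule power2_eq_imp_eq) simp_all
qed

lemma cnorm_minus: "cnorm (- x) = cnorm x"
  using cnorm_scaleC[of "- 1" x] by (simp add: scaleC_minus_one)

lemma cnorm_minus_commute: "cnorm (x - y) = cnorm (y - x)"
  using cnorm_minus[of "x - y"] by simp

lemma cnorm_add_power2: "(cnorm (x + y))\<^sup>2 = (cnorm x)\<^sup>2 + (cnorm y)\<^sup>2 + 2 * Re (cinner x y)"
proof -
  have "Re (cinner y x) = Re (cinner x y)"
    by (subst cinner_commute) simp
  then show ?thesis
    by (simp add: cnorm_power2 cinner_add_left cinner_add_right)
qed

lemma cnorm_diff_power2: "(cnorm (x - y))\<^sup>2 = (cnorm x)\<^sup>2 + (cnorm y)\<^sup>2 - 2 * Re (cinner x y)"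
  using cnorm_add_power2[of x "- y"] by (simp add: cnorm_minus cinner_minus_right)

lemma Re_cinner_polar: "Re (cinner x y) = ((cnorm (x + y))\<^sup>2 - (cnorm x)\<^sup>2 - (cnorm y)\<^sup>2) / 2"
  by (simp add: cnorm_add_power2)

lemma Im_cinner_polar:
  "Im (cinner x y) = ((cnorm x)\<^sup>2 + (cnorm y)\<^sup>2 - (cnorm (x + \<i> *\<^sub>C y))\<^sup>2) / 2"
  by (simp add: cnorm_add_power2 cnorm_scaleC cinner_scaleC_right)

text \<open>Polarisation: the norms of \<open>x + y\<close> and \<open>x + \<i> *\<^sub>C y\<close>
  carry the real and the imaginary part of the inner product. Used with \<open>t = 1\<close> for
  linear isometries.\<close>

lemma cinner_eqI_norm:
  assumes "(cnorm (x + y))\<^sup>2 = t * (cnorm (x' + y'))\<^sup>2"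
    and "(cnorm (x + \<i> *\<^sub>C y))\<^sup>2 = t * (cnorm (x' + \<i> *\<^sub>C y'))\<^sup>2"
    and "(cnorm x)\<^sup>2 = t * (cnorm x')\<^sup>2" "(cnorm y)\<^sup>2 = t * (cnorm y')\<^sup>2"
  shows "cinner x y = of_real t * cinner x' y'"
  using assms by (simp add: complex_eq_iff Re_cinner_polar Im_cinner_polar algebra_simps)

text \<open>Polarisation for antilinear maps, where \<open>- \<i>\<close> on the source side
  corresponds to \<open>\<i>\<close> on the image side: the imaginary part changes sign, hence the
  swapped arguments. Used with \<open>t = 1\<close> for conjugations and with \<open>t\<close> the
  value of the density for \<open>C\<close>.\<close>

lemma cinner_eqI_norm_cnj:
  assumes "(cnorm (x + y))\<^sup>2 = t * (cnorm (x' + y'))\<^sup>2"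
    and "(cnorm (x + \<i> *\<^sub>C y))\<^sup>2 = t * (cnorm (x' + (- \<i>) *\<^sub>C y'))\<^sup>2"
    and "(cnorm x)\<^sup>2 = t * (cnorm x')\<^sup>2" "(cnorm y)\<^sup>2 = t * (cnorm y')\<^sup>2"
  shows "cinner x y = of_real t * cinner y' x'"
proof -
  have "(cnorm (x' + (- \<i>) *\<^sub>C y'))\<^sup>2 = (cnorm x')\<^sup>2 + (cnorm y')\<^sup>2 + 2 * Im (cinner x' y')"
    by (simp add: cnorm_add_power2 cnorm_scaleC cinner_scaleC_right)
  then have "Im (cinner x y) = - t * Im (cinner x' y')"
    using assms by (simp add: Im_cinner_polar[of x y] algebra_simps)
  moreover have "Re (cinner x y) = t * Re (cinner x' y')"
    using assms by (simp add: Re_cinner_polar algebra_simps)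
  ultimately show ?thesis
    by (simp add: complex_eq_iff cinner_commute[of y' x'])
qed

lemma norm_cinner_le: "cmod (cinner x y) \<le> cnorm x * cnorm y"
proof (cases "x = 0")
  case False
  \<comment> \<open>The coefficient of the orthogonal projection of \<open>y\<close> onto the line
    through \<open>x\<close>; Pythagoras then gives Cauchy-Schwarz.\<close>
  define a where "a = cinner x y / cinner x x"
  define z where "z = y - a *\<^sub>C x"
  have "cinner x x \<noteq> 0"
    using False by (simp add: cinner_eq_zero)
  then have orth: "cinner x z = 0"
    by (simp add: z_def a_def cinner_diff_right cinner_scaleC_right)
  have "y = z + a *\<^sub>C x"
    by (simp add: z_def)
  moreover have "cinner z x = 0"
    using orth by (metis cinner_commute complex_cnj_zero)
  ultimately have "(cnorm y)\<^sup>2 = (cnorm z)\<^sup>2 + (cnorm (a *\<^sub>C x))\<^sup>2"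
    by (simp add: cnorm_add_power2 cinner_scaleC_right)
  then have "(cmod a * cnorm x)\<^sup>2 \<le> (cnorm y)\<^sup>2"
    by (simp add: cnorm_scaleC)
  then have "cmod a * cnorm x \<le> cnorm y"
    by (rule power2_le_imp_le) simp
  moreover have "cmod a = cmod (cinner x y) / (cnorm x)\<^sup>2"
    by (simp add: a_def norm_divide cinner_self norm_power)
  moreover have "cnorm x > 0"
    using False by (simp add: less_le)
  ultimately show ?thesis
    using False by (simp add: field_simps power2_eq_square)
qed simp

lemma cnorm_triangle: "cnorm (x + y) \<le> cnorm x + cnorm y"
proof -
  have "Re (cinner x y) \<le> cnorm x * cnorm y"
    using norm_cinner_le[of x y] complex_Re_le_cmod order_trans by blast
  then have "(cnorm (x + y))\<^sup>2 \<le> (cnorm x + cnorm y)\<^sup>2"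
    by (simp add: cnorm_add_power2 power2_sum)
  then show ?thesis
    by (rule power2_le_imp_le) simp
qed

lemma cnorm_triangle_minus: "cnorm (x - y) \<le> cnorm x + cnorm y"
  using cnorm_triangle[of x "- y"] by (simp add: cnorm_minus)

lemma cnorm_triangle_diff: "cnorm (x - z) \<le> cnorm (x - y) + cnorm (y - z)"
  using cnorm_triangle[of "x - y" "y - z"] by simp

section \<open>Norm convergence and closed subspaces\<close>

text \<open>The class \<open>complex_inner\<close> carries no topology, so convergence is reduced to
  that of a real sequence; \<open>hlim_iff\<close> matches the form used in the completeness axiom
  and in \<open>hclosed_subspace\<close>.\<close>

definition hlim :: "(nat \<Rightarrow> 'a::complex_inner) \<Rightarrow> 'a \<Rightarrow> bool" where
  "hlim X l \<longleftrightarrow> (\<lambda>n. cnorm (X n - l)) \<longlonglongrightarrow> 0"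

lemma hlim_iff: "hlim X l \<longleftrightarrow> (\<forall>e>0. \<exists>N::nat. \<forall>n\<ge>N. cnorm (X n - l) < e)"
  by (simp add: hlim_def LIMSEQ_iff)

lemma hlim_unique:
  assumes "hlim X l" "hlim X l'"
  shows "l = l'"
proof -
  have "(\<lambda>n. cnorm (X n - l) + cnorm (X n - l')) \<longlonglongrightarrow> 0 + 0"
    using assms unfolding hlim_def by (rule tendsto_add)
  moreover have "cnorm (l - l') \<le> cnorm (X n - l) + cnorm (X n - l')" for n
    using cnorm_triangle_diff[of l l' "X n"] by (simp add: cnorm_minus_commute[of l])
  ultimately have "cnorm (l - l') \<le> 0"
    by (intro LIMSEQ_le_const[of _ "0::real"]) auto
  then have "cnorm (l - l') = 0"
    by (intro antisym) auto
  then show ?thesis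
    by simp
qed

lemma hlim_add:
  assumes "hlim X l" "hlim Y m"
  shows "hlim (\<lambda>n. X n + Y n) (l + m)"
proof -
  have *: "(\<lambda>n. cnorm (X n - l) + cnorm (Y n - m)) \<longlonglongrightarrow> 0"
    using tendsto_add[OF assms[unfolded hlim_def]] by simp
  show ?thesis
    unfolding hlim_def
  proof (rule tendsto_sandwich[OF _ _ tendsto_const *])
    show "\<forall>\<^sub>F n in sequentially. cnorm (X n + Y n - (l + m)) \<le> cnorm (X n - l) + cnorm (Y n - m)"
    proof (intro always_eventually allI)
      fix n
      have eq: "X n + Y n - (l + m) = (X n - l) + (Y n - m)"
        by simp
      show "cnorm (X n + Y n - (l + m)) \<le> cnorm (X n - l) + cnorm (Y n - m)"
        unfolding eq by (rule cnorm_triangle)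
    qed
  qed simp
qed

lemma hlim_scaleC:
  assumes "hlim X l"
  shows "hlim (\<lambda>n. a *\<^sub>C X n) (a *\<^sub>C l)"
  using tendsto_mult_right_zero[OF assms[unfolded hlim_def], of "cmod a"]
  by (simp add: hlim_def scaleC_diff_right[symmetric] cnorm_scaleC)

lemma hlim_cinner:
  assumes "hlim X l"
  shows "(\<lambda>n. cinner v (X n)) \<longlonglongrightarrow> cinner v l"
proof (subst LIM_zero_iff[symmetric], rule Lim_null_comparison)
  show "\<forall>\<^sub>F n in sequentially. norm (cinner v (X n) - cinner v l) \<le> cnorm v * cnorm (X n - l)"
    using norm_cinner_le[of v] by (intro always_eventually allI) (simp add: cinner_diff_right[symmetric])
  show "(\<lambda>n. cnorm v * cnorm (X n - l)) \<longlonglongrightarrow> 0"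
    using assms unfolding hlim_def by (rule tendsto_mult_right_zero)
qed

lemma hlim_cnorm:
  assumes "hlim X l"
  shows "(\<lambda>n. cnorm (X n)) \<longlonglongrightarrow> cnorm l"
proof (subst LIM_zero_iff[symmetric], rule Lim_null_comparison)
  have "\<bar>cnorm (X n) - cnorm l\<bar> \<le> cnorm (X n - l)" for n
    using cnorm_triangle[of "X n - l" l] cnorm_triangle[of "l - X n" "X n"]
    by (simp add: abs_le_iff cnorm_minus_commute[of l])
  then show "\<forall>\<^sub>F n in sequentially. norm (cnorm (X n) - cnorm l) \<le> cnorm (X n - l)"
    by simp
  show "(\<lambda>n. cnorm (X n - l)) \<longlonglongrightarrow> 0"
    using assms unfolding hlim_def .
qed

lemma hclosed_hlim:
  assumes "hclosed_subspace S" "hlim X l" "\<And>n. X n \<in> S"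
  shows "l \<in> S"
  using assms unfolding hclosed_subspace_def hlim_iff by blast

lemma hclosed_zero: "hclosed_subspace S \<Longrightarrow> 0 \<in> S"
  and hclosed_add: "hclosed_subspace S \<Longrightarrow> x \<in> S \<Longrightarrow> y \<in> S \<Longrightarrow> x + y \<in> S"
  and hclosed_scaleC: "hclosed_subspace S \<Longrightarrow> x \<in> S \<Longrightarrow> c *\<^sub>C x \<in> S"
  by (auto simp: hclosed_subspace_def)

lemma hclosed_diff: "hclosed_subspace S \<Longrightarrow> x \<in> S \<Longrightarrow> y \<in> S \<Longrightarrow> x - y \<in> S"
  using hclosed_add[of S x "(- 1) *\<^sub>C y"] hclosed_scaleC[of S y "- 1"]
  by (simp add: scaleC_minus_one)

lemma hclosed_sum: "hclosed_subspace S \<Longrightarrow> (\<And>k. k \<in> F \<Longrightarrow> f k \<in> S) \<Longrightarrow> sum f F \<in> S"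
  by (induction F rule: infinite_finite_induct) (auto intro: hclosed_zero hclosed_add)

text \<open>Zero vectors are allowed, so that finite and infinite orthonormal bases can both be
  enumerated by the natural numbers.\<close>
definition orthoseq :: "(nat \<Rightarrow> 'a::complex_inner) \<Rightarrow> bool" where
  "orthoseq e \<longleftrightarrow> (\<forall>i j. i \<noteq> j \<longrightarrow> cinner (e i) (e j) = 0) \<and> (\<forall>i. cinner (e i) (e i) \<in> {0, 1})"

lemma orthoseq_cong:
  assumes "orthoseq e" "\<And>i j. cinner (d i) (d j) = cinner (e i) (e j)"
  shows "orthoseq d"
  using assms by (simp add: orthoseq_def)

lemma orthoseq_cases:
  assumes "orthoseq e"
  obtains "e i = 0" | "cinner (e i) (e i) = 1"
  using assms unfolding orthoseq_def by (metis cinner_eq_zero empty_iff insert_iff)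

text \<open>The scalar is 1 at unit vectors, and at zero entries both sides vanish; this spares case
  distinctions wherever \<open>cinner (e j) (e j)\<close> survives in a formula.\<close>

lemma orthoseq_scale_self:
  assumes "orthoseq e"
  shows "cinner (e j) (e j) *\<^sub>C e j = e j"
  by (rule orthoseq_cases[OF assms, of j]) (simp_all add: scaleC_one)

lemma cinner_orthoseq_sum:
  assumes "orthoseq e" "finite F"
  shows "cinner (e j) (\<Sum>k\<in>F. c k *\<^sub>C e k) = (if j \<in> F then c j * cinner (e j) (e j) else 0)"
proof -
  have "cinner (e j) (\<Sum>k\<in>F. c k *\<^sub>C e k) = (\<Sum>k\<in>F. if k = j then c j * cinner (e j) (e j) else 0)"
    using assms(1) unfolding cinner_sum_right orthoseq_def
    by (intro sum.cong) (auto simp: cinner_scaleC_right)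
  then show ?thesis
    using assms(2) by (simp add: sum.delta)
qed

lemma cnorm_orthoseq_sum:
  assumes "orthoseq e" "finite F"
  shows "(cnorm (\<Sum>k\<in>F. c k *\<^sub>C e k))\<^sup>2 = (\<Sum>k\<in>F. (cmod (c k))\<^sup>2 * (cnorm (e k))\<^sup>2)"
proof -
  have "cinner (\<Sum>k\<in>F. c k *\<^sub>C e k) (\<Sum>k\<in>F. c k *\<^sub>C e k) =
      (\<Sum>j\<in>F. cnj (c j) * (c j * cinner (e j) (e j)))"
    unfolding cinner_sum_left
    by (intro sum.cong) (auto simp: cinner_scaleC_left cinner_orthoseq_sum[OF assms])
  also have "\<dots> = complex_of_real (\<Sum>k\<in>F. (cmod (c k))\<^sup>2 * (cnorm (e k))\<^sup>2)"
    by (simp only: cinner_self cnj_mult_self of_real_sum)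
  finally show ?thesis
    by (simp add: cnorm_power2)
qed

definition hpart :: "(nat \<Rightarrow> complex) \<Rightarrow> (nat \<Rightarrow> 'a::complex_inner) \<Rightarrow> nat \<Rightarrow> 'a" where
  "hpart c e n = (\<Sum>k<n. c k *\<^sub>C e k)"

text \<open>The series of \<open>c k *\<^sub>C e k\<close>, as a chosen norm limit of the partial
  sums. It has content only where a limit exists, which \<open>hlim_hsum\<close> secures for
  square-summable coefficients.\<close>

definition hsum :: "(nat \<Rightarrow> complex) \<Rightarrow> (nat \<Rightarrow> 'a::complex_inner) \<Rightarrow> 'a" where
  "hsum c e = (SOME l. hlim (hpart c e) l)"

lemma hsumI: "hlim (hpart c e) l \<Longrightarrow> hsum c e = l"
  unfolding hsum_def by (rule some_equality) (auto intro: hlim_unique)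

lemma cnorm_hpart:
  assumes "orthoseq e"
  shows "(cnorm (hpart c e n))\<^sup>2 = (\<Sum>k<n. (cmod (c k))\<^sup>2 * (cnorm (e k))\<^sup>2)"
  unfolding hpart_def using assms by (rule cnorm_orthoseq_sum) simp

lemma orthoseq_cnorm_le: "orthoseq e \<Longrightarrow> (cnorm (e k))\<^sup>2 \<le> 1"
  by (rule orthoseq_cases[of e k]) (auto simp: cnorm_power2)

text \<open>By Pythagoras the squared distance of two partial sums is at most a block of the
  convergent series of squared moduli, so the partial sums are Cauchy; completeness does the
  rest.\<close>

lemma hlim_hsum:
  fixes e :: "nat \<Rightarrow> 'a::chilbert"
  assumes "orthoseq e" "summable (\<lambda>k. (cmod (c k))\<^sup>2)"
  shows "hlim (hpart c e) (hsum c e)"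
proof -
  have diff: "(cnorm (hpart c e m - hpart c e n))\<^sup>2 \<le> (\<Sum>k\<in>{n..<m}. (cmod (c k))\<^sup>2)" if "n \<le> m" for m n
  proof -
    have "hpart c e m - hpart c e n = (\<Sum>k\<in>{n..<m}. c k *\<^sub>C e k)"
      using that by (simp add: hpart_def lessThan_atLeast0 sum_diff_nat_ivl)
    then have "(cnorm (hpart c e m - hpart c e n))\<^sup>2 = (\<Sum>k\<in>{n..<m}. (cmod (c k))\<^sup>2 * (cnorm (e k))\<^sup>2)"
      using cnorm_orthoseq_sum[OF assms(1)] by simp
    also have "\<dots> \<le> (\<Sum>k\<in>{n..<m}. (cmod (c k))\<^sup>2)"
      using orthoseq_cnorm_le[OF assms(1)] by (intro sum_mono mult_left_le) auto
    finally show ?thesis .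
  qed
  have "\<exists>l. \<forall>\<epsilon>>0. \<exists>N::nat. \<forall>n\<ge>N. sqrt (Re (cinner (hpart c e n - l) (hpart c e n - l))) < \<epsilon>"
  proof (rule cauchy_converges, intro allI impI)
    fix \<epsilon> :: real assume "\<epsilon> > 0"
    then obtain N where N: "\<And>m n. m \<ge> N \<Longrightarrow> norm (\<Sum>k\<in>{m..<n}. (cmod (c k))\<^sup>2) < \<epsilon>\<^sup>2"
      using assms(2) unfolding summable_Cauchy by (meson zero_less_power)
    have less: "cnorm (hpart c e m - hpart c e n) < \<epsilon>" if "n \<ge> N" "n \<le> m" for m n
    proof -
      have "(cnorm (hpart c e m - hpart c e n))\<^sup>2 < \<epsilon>\<^sup>2"
        using diff[OF that(2)] N[OF that(1), of m] by simp
      then show ?thesis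
        using \<open>\<epsilon> > 0\<close> by (simp add: power_less_imp_less_base)
    qed
    have less': "cnorm (hpart c e m - hpart c e n) < \<epsilon>" if "n \<ge> N" "m \<ge> N" for m n
    proof (rule linorder_le_cases[of n m])
      assume "m \<le> n"
      show ?thesis
        by (subst cnorm_minus_commute) (rule less[OF \<open>m \<ge> N\<close> \<open>m \<le> n\<close>])
    qed (rule less[OF \<open>n \<ge> N\<close>])
    show "\<exists>N. \<forall>m\<ge>N. \<forall>n\<ge>N.
        sqrt (Re (cinner (hpart c e m - hpart c e n) (hpart c e m - hpart c e n))) < \<epsilon>"
      using less' unfolding cnorm_def by blast
  qed
  then obtain l where "hlim (hpart c e) l"
    unfolding hlim_iff cnorm_def by blast
  then show ?thesis
    unfolding hsum_def by (rule someI)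
qed

lemma cnorm_hsum:
  fixes e :: "nat \<Rightarrow> 'a::chilbert"
  assumes "orthoseq e" "summable (\<lambda>k. (cmod (c k))\<^sup>2)"
  shows "(\<lambda>k. (cmod (c k))\<^sup>2 * (cnorm (e k))\<^sup>2) sums (cnorm (hsum c e))\<^sup>2"
  using tendsto_power[OF hlim_cnorm[OF hlim_hsum[OF assms]], of 2] cnorm_hpart[OF assms(1)]
  by (simp add: sums_def)

lemma hsum_in:
  fixes e :: "nat \<Rightarrow> 'a::chilbert"
  assumes "hclosed_subspace S" "\<And>k. e k \<in> S" "orthoseq e" "summable (\<lambda>k. (cmod (c k))\<^sup>2)"
  shows "hsum c e \<in> S"
  by (rule hclosed_hlim[OF assms(1) hlim_hsum[OF assms(3,4)]])
    (auto simp: hpart_def intro!: hclosed_sum hclosed_scaleC assms)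

lemma cinner_hsum:
  fixes e :: "nat \<Rightarrow> 'a::chilbert"
  assumes "orthoseq e" "summable (\<lambda>k. (cmod (c k))\<^sup>2)"
  shows "(\<lambda>k. c k * cinner v (e k)) sums cinner v (hsum c e)"
  using hlim_cinner[OF hlim_hsum[OF assms], of v]
  by (simp add: sums_def hpart_def cinner_sum_right cinner_scaleC_right)

lemma cinner_hsum_self:
  fixes e :: "nat \<Rightarrow> 'a::chilbert"
  assumes "orthoseq e" "summable (\<lambda>k. (cmod (c k))\<^sup>2)"
  shows "cinner (e j) (hsum c e) = c j * cinner (e j) (e j)"
proof -
  have "(\<lambda>k. c k * cinner (e j) (e k)) sums (\<Sum>k\<in>{j}. c k * cinner (e j) (e k))"
    using assms(1) by (intro sums_finite) (auto simp: orthoseq_def)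
  then show ?thesis
    using cinner_hsum[OF assms, of "e j"] sums_unique2 by fastforce
qed

lemma hlim_cong_0:
  assumes "hlim X l" "\<And>n. X n = Y n"
  shows "hlim Y l"
  using assms by (simp add: hlim_def)

lemma hsum_add:
  fixes e :: "nat \<Rightarrow> 'a::chilbert"
  assumes "orthoseq e" "summable (\<lambda>k. (cmod (c k))\<^sup>2)" "summable (\<lambda>k. (cmod (d k))\<^sup>2)"
  shows "hsum (\<lambda>k. c k + d k) e = hsum c e + hsum d e"
  by (rule hsumI, rule hlim_cong_0[OF hlim_add[OF hlim_hsum[OF assms(1,2)] hlim_hsum[OF assms(1,3)]]])
    (simp add: hpart_def scaleC_add_left sum.distrib)

lemma hsum_scaleC:
  fixes e :: "nat \<Rightarrow> 'a::chilbert"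
  assumes "orthoseq e" "summable (\<lambda>k. (cmod (c k))\<^sup>2)"
  shows "hsum (\<lambda>k. a * c k) e = a *\<^sub>C hsum c e"
  by (rule hsumI, rule hlim_cong_0[OF hlim_scaleC[OF hlim_hsum[OF assms]]])
    (simp add: hpart_def scaleC_sum_right scaleC_scaleC)

section \<open>Orthonormal bases as sequences\<close>

text \<open>Completeness of the basis is stated as convergence of the Fourier expansion, from which
  Parseval is immediate; \<open>onb_seqI\<close> derives it from density of the span.\<close>

definition onb_seq :: "'a::complex_inner set \<Rightarrow> (nat \<Rightarrow> 'a) \<Rightarrow> bool" where
  "onb_seq S b \<longleftrightarrow> range b \<subseteq> S \<and> orthoseq b \<and> (\<forall>w\<in>S. hlim (hpart (\<lambda>k. cinner (b k) w) b) w)"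

lemma orthoseq_coeff:
  assumes "orthoseq e"
  shows "(cmod (cinner (e k) w))\<^sup>2 * (cnorm (e k))\<^sup>2 = (cmod (cinner (e k) w))\<^sup>2"
  by (rule orthoseq_cases[OF assms, of k]) (auto simp: cnorm_power2)

text \<open>The partial sum is the orthogonal projection of \<open>w\<close>, so its inner product
  with \<open>w\<close> is its own squared norm. The exact remainder is kept because
  \<open>hsum_eqI\<close> needs it to vanish in the limit.\<close>

lemma bessel:
  assumes "orthoseq e"
  shows "(cnorm (hpart (\<lambda>k. cinner (e k) w) e n))\<^sup>2 + (cnorm (hpart (\<lambda>k. cinner (e k) w) e n - w))\<^sup>2
    = (cnorm w)\<^sup>2"
proof -
  let ?p = "hpart (\<lambda>k. cinner (e k) w) e n"
  have "cinner ?p w = complex_of_real (\<Sum>k<n. (cmod (cinner (e k) w))\<^sup>2)"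
    by (simp add: hpart_def cinner_sum_left cinner_scaleC_left complex_norm_square mult.commute
        del: of_real_power)
  then have "cinner ?p w = complex_of_real ((cnorm ?p)\<^sup>2)"
    using assms by (simp add: cnorm_hpart orthoseq_coeff)
  then show ?thesis
    by (simp add: cnorm_diff_power2)
qed

lemma parseval:
  assumes "onb_seq S b" "w \<in> S"
  shows "(\<lambda>k. (cmod (cinner (b k) w))\<^sup>2) sums (cnorm w)\<^sup>2"
proof -
  have b: "orthoseq b" "hlim (hpart (\<lambda>k. cinner (b k) w) b) w"
    using assms by (auto simp: onb_seq_def)
  show ?thesis
    using tendsto_power[OF hlim_cnorm[OF b(2)], of 2]
    by (simp add: sums_def cnorm_hpart[OF b(1)] orthoseq_coeff[OF b(1)])
qed

lemma summable_coeff: "onb_seq S b \<Longrightarrow> w \<in> S \<Longrightarrow> summable (\<lambda>k. (cmod (cinner (b k) w))\<^sup>2)"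
  using parseval sums_summable by blast

text \<open>The projections \<open>P n\<close> are contractions and fix each finite combination
  \<open>y\<close> of basis vectors once \<open>n\<close> is large. Then
  \<open>P n w - w = P n (w - y) - (w - y)\<close> has norm at most twice the distance from
  \<open>w\<close> to \<open>y\<close>, which density makes small.\<close>

lemma onb_seqI:
  assumes S: "hclosed_subspace S" and b: "range b \<subseteq> S" "orthoseq b"
    and dense: "\<And>w e. w \<in> S \<Longrightarrow> e > 0 \<Longrightarrow> \<exists>y\<in>hcspan (range b). cnorm (w - y) < e"
  shows "onb_seq S b"
proof -
  define P where "P n w = hpart (\<lambda>k. cinner (b k) w) b n" for n w
  have P_diff: "P n (w - y) = P n w - P n y" for n w y
    unfolding P_def hpart_def cinner_diff_right scaleC_diff_left by (rule sum_subtractf)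
  have P_le: "cnorm (P n w) \<le> cnorm w" for n w
  proof (rule power2_le_imp_le)
    show "(cnorm (P n w))\<^sup>2 \<le> (cnorm w)\<^sup>2"
      using bessel[OF b(2), of w n] zero_le_power2[of "cnorm (P n w - w)"] unfolding P_def by linarith
  qed (rule cnorm_ge_0)
  have P_b: "P n (b j) = b j" if "j < n" for n j
  proof -
    have 0: "cinner (b k) (b j) = 0" if "k \<noteq> j" for k
      using b(2) that by (simp add: orthoseq_def)
    have "P n (b j) = (\<Sum>k<n. if k = j then cinner (b j) (b j) *\<^sub>C b j else 0)"
      unfolding P_def hpart_def by (rule sum.cong) (auto simp: 0)
    also have "\<dots> = cinner (b j) (b j) *\<^sub>C b j"
      using that by (simp add: sum.delta)
    also have "\<dots> = b j"
      by (rule orthoseq_scale_self[OF b(2)])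
    finally show ?thesis .
  qed
  have P_add: "P n (w + y) = P n w + P n y" for n w y
    by (simp add: P_def hpart_def cinner_add_right scaleC_add_left sum.distrib)
  have P_scale: "P n (c *\<^sub>C w) = c *\<^sub>C P n w" for n c w
    by (simp add: P_def hpart_def cinner_scaleC_right scaleC_sum_right scaleC_scaleC)
  have P_zero: "P n 0 = 0" for n
    by (simp add: P_def hpart_def)
  have "hlim (\<lambda>n. P n w) w" if w: "w \<in> S" for w
    unfolding hlim_iff
  proof (intro allI impI)
    fix \<epsilon> :: real assume "\<epsilon> > 0"
    then obtain y where y: "y \<in> hcspan (range b)" "cnorm (w - y) < \<epsilon> / 2"
      using dense[OF w, of "\<epsilon> / 2"] by auto
    then obtain F c where F: "finite F" "F \<subseteq> range b" "y = (\<Sum>x\<in>F. c x *\<^sub>C x)"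
      by (auto simp: hcspan_def)
    then obtain K where K: "finite K" "F = b ` K"
      by (meson finite_subset_image)
    then obtain N where N: "\<And>k. k \<in> K \<Longrightarrow> k < N"
      by (metis finite_nat_set_iff_bounded)
    have "cnorm (P n w - w) < \<epsilon>" if "n \<ge> N" for n
    proof -
      have fix_F: "P n x = x" if x: "x \<in> F" for x
      proof -
        obtain k where "k \<in> K" "x = b k"
          using x K(2) by blast
        then show ?thesis
          using P_b[of k n] N[of k] \<open>n \<ge> N\<close> by simp
      qed
      have "P n (\<Sum>x\<in>G. c x *\<^sub>C x) = (\<Sum>x\<in>G. c x *\<^sub>C x)" if "G \<subseteq> F" for G
        using that by (induction G rule: infinite_finite_induct)
          (auto simp: P_zero P_add P_scale fix_F)
      from this[OF subset_refl] have "P n y = y"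
        by (simp only: F(3))
      then have "P n w - w = P n (w - y) - (w - y)"
        by (simp add: P_diff)
      then have "cnorm (P n w - w) \<le> cnorm (P n (w - y)) + cnorm (w - y)"
        by (simp only: cnorm_triangle_minus)
      also have "\<dots> < \<epsilon>"
        using P_le[of n "w - y"] y(2) by linarith
      finally show ?thesis .
    qed
    then show "\<exists>N. \<forall>n\<ge>N. cnorm (P n w - w) < \<epsilon>"
      by blast
  qed
  then show ?thesis
    using b by (auto simp: onb_seq_def P_def[abs_def])
qed

lemma hilbert_dim_onb_seq:
  assumes "hclosed_subspace S" "hilbert_dim S k"
  obtains b where "onb_seq S b"
proof -
  obtain B where B: "B \<subseteq> S" "horthonormal B" "\<And>x e. x \<in> S \<Longrightarrow> e > 0 \<Longrightarrow> \<exists>y\<in>hcspan B. cnorm (x - y) < e"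
    and cB: "countable B"
    using assms(2) unfolding hilbert_dim_def by (metis countable_finite)
  \<comment> \<open>Indices outside the range of the enumeration get 0: for finite \<open>B\<close>,
    \<open>from_nat_into\<close> would repeat elements there and destroy orthogonality.\<close>
  define b where "b n = (if n \<in> to_nat_on B ` B then from_nat_into B n else 0)" for n
  have b_to: "b (to_nat_on B x) = x" if "x \<in> B" for x
    using that cB by (simp add: b_def)
  have b_or: "b n = 0 \<or> b n \<in> B \<and> n = to_nat_on B (b n)" for n
    using cB by (auto simp: b_def)
  have "orthoseq b"
    unfolding orthoseq_def
  proof (intro conjI allI impI)
    fix i j :: nat
    show "cinner (b i) (b i) \<in> {0, 1}"
      using b_or[of i] B(2) by (auto simp: horthonormal_def)
    assume "i \<noteq> j"
    then show "cinner (b i) (b j) = 0"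
      using b_or[of i] b_or[of j] B(2) by (metis cinner_zero_left cinner_zero_right horthonormal_def)
  qed
  moreover have "range b \<subseteq> S"
    using b_or B(1) hclosed_zero[OF assms(1)] by (metis image_subset_iff subsetD)
  moreover have "B \<subseteq> range b"
    using b_to by (metis rangeI subsetI)
  then have "hcspan B \<subseteq> hcspan (range b)"
    unfolding hcspan_def by fastforce
  ultimately have "onb_seq S b"
    using B(3) by (intro onb_seqI assms(1)) (meson subsetD)+
  then show ?thesis
    by (rule that)
qed

section \<open>Isometries and conjugations prescribed on a basis\<close>

text \<open>Equal Gram matrices make \<open>d\<close> orthonormal with zeros at the same places as
  \<open>b\<close>, so Parseval for \<open>b\<close> also computes the norm of the image. Nothing is
  said about surjectivity; for the operators in (c) it is obtained later from
  \<open>C C = 1\<close>.\<close>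

lemma onb_map_isometry:
  fixes d :: "nat \<Rightarrow> 'a::chilbert"
  assumes S: "hclosed_subspace S" and b: "onb_seq S b" and d: "\<And>k. d k \<in> S"
    and iso: "\<And>i j. cinner (d i) (d j) = cinner (b i) (b j)"
  defines "W \<equiv> \<lambda>w. hsum (\<lambda>k. cinner (b k) w) d"
  shows "hlinear_on S W" and "\<forall>w\<in>S. cnorm (W w) = cnorm w"
    and "\<And>j. W (b j) = d j"
proof -
  have od: "orthoseq d"
    using b iso by (auto simp: onb_seq_def intro: orthoseq_cong)
  have nd: "(cnorm (d k))\<^sup>2 = (cnorm (b k))\<^sup>2" for k
    by (simp add: cnorm_power2 iso)
  note sm = summable_coeff[OF b]
  have ob: "orthoseq b"
    using b by (simp add: onb_seq_def)
  show "hlinear_on S W"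
    unfolding hlinear_on_def W_def
    using hsum_in[OF S d od sm] hsum_add[OF od sm sm] hsum_scaleC[OF od sm]
    by (simp add: cinner_add_right cinner_scaleC_right)
  show "\<forall>w\<in>S. cnorm (W w) = cnorm w"
  proof
    fix w assume w: "w \<in> S"
    have "(\<lambda>k. (cmod (cinner (b k) w))\<^sup>2) sums (cnorm (W w))\<^sup>2"
      using cnorm_hsum[OF od sm[OF w]] by (simp add: W_def nd orthoseq_coeff[OF ob])
    then have "(cnorm (W w))\<^sup>2 = (cnorm w)\<^sup>2"
      using parseval[OF b w] sums_unique2 by blast
    then show "cnorm (W w) = cnorm w"
      by (simp add: power2_eq_iff_nonneg)
  qed
  show "W (b j) = d j" for j
    unfolding W_def
  proof (rule hsumI, unfold hlim_iff, intro allI impI exI)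
    fix \<epsilon> :: real and n assume "\<epsilon> > 0" "n \<ge> Suc j"
    have "hpart (\<lambda>k. cinner (b k) (b j)) d n = (\<Sum>k<n. if k = j then cinner (b j) (b j) *\<^sub>C d j else 0)"
      using ob unfolding hpart_def orthoseq_def by (intro sum.cong) auto
    also have "\<dots> = cinner (d j) (d j) *\<^sub>C d j"
      using \<open>n \<ge> Suc j\<close> by (simp add: sum.delta iso)
    also have "\<dots> = d j"
      by (rule orthoseq_scale_self[OF od])
    finally show "cnorm (hpart (\<lambda>k. cinner (b k) (b j)) d n - d j) < \<epsilon>"
      using \<open>\<epsilon> > 0\<close> by simp
  qed
qed

text \<open>Conjugating all coordinates in a fixed basis. Condition (c) speaks of every family of
  conjugations, so deducing (a) from it requires that one exists.\<close>

lemma conjugation_on_exists: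
  fixes b :: "nat \<Rightarrow> 'a::chilbert"
  assumes S: "hclosed_subspace S" and b: "onb_seq S b"
  shows "conjugation_on S (\<lambda>w. hsum (\<lambda>k. cnj (cinner (b k) w)) b)" (is "conjugation_on S ?J")
proof -
  have ob: "orthoseq b" and bS: "\<And>k. b k \<in> S"
    using b by (auto simp: onb_seq_def)
  have sm: "summable (\<lambda>k. (cmod (cnj (cinner (b k) w)))\<^sup>2)" if "w \<in> S" for w
    using summable_coeff[OF b that] by simp
  have in_S: "?J w \<in> S" if "w \<in> S" for w
    by (rule hsum_in[OF S bS ob sm[OF that]])
  have norm: "cnorm (?J w) = cnorm w" if w: "w \<in> S" for w
  proof -
    have "(\<lambda>k. (cmod (cinner (b k) w))\<^sup>2) sums (cnorm (?J w))\<^sup>2"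
      using cnorm_hsum[OF ob sm[OF w]] by (simp add: orthoseq_coeff[OF ob])
    then have "(cnorm (?J w))\<^sup>2 = (cnorm w)\<^sup>2"
      using parseval[OF b w] sums_unique2 by blast
    then show ?thesis
      by (simp add: power2_eq_iff_nonneg)
  qed
  have coeff: "cnj (cinner (b j) (?J w)) = cinner (b j) w" if "w \<in> S" for j w
    unfolding cinner_hsum_self[OF ob sm[OF that]]
    by (rule orthoseq_cases[OF ob, of j]) auto
  have invol: "?J (?J w) = w" if w: "w \<in> S" for w
    using b w unfolding coeff[OF w] by (auto intro: hsumI simp: onb_seq_def)
  show ?thesis
    unfolding conjugation_on_def
    using in_S norm invol hsum_add[OF ob sm sm] hsum_scaleC[OF ob sm]
    by (simp add: cinner_add_right cinner_scaleC_right)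
qed

lemma conjugation_on_cinner:
  assumes S: "hclosed_subspace S" and J: "conjugation_on S J" and xy: "x \<in> S" "y \<in> S"
  shows "cinner (J x) (J y) = cinner y x"
proof -
  have add: "J (u + v) = J u + J v" if "u \<in> S" "v \<in> S" for u v
    using J that by (auto simp: conjugation_on_def)
  have norm: "cnorm (J u) = cnorm u" if "u \<in> S" for u
    using J that by (auto simp: conjugation_on_def)
  have scale: "J (c *\<^sub>C u) = cnj c *\<^sub>C J u" if "u \<in> S" for c u
    using J that by (auto simp: conjugation_on_def)
  have 1: "cnorm (J x + J y) = cnorm (x + y)"
    using add[OF xy] norm[of "x + y"] xy hclosed_add[OF S] by simp
  have iy: "(- \<i>) *\<^sub>C y \<in> S"
    using xy by (intro hclosed_scaleC[OF S])
  have "J x + \<i> *\<^sub>C J y = J (x + (- \<i>) *\<^sub>C y)"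
    using add[OF xy(1) iy] scale[OF xy(2)] by simp
  then have 2: "cnorm (J x + \<i> *\<^sub>C J y) = cnorm (x + (- \<i>) *\<^sub>C y)"
    using norm[of "x + (- \<i>) *\<^sub>C y"] hclosed_add[OF S xy(1) iy] by simp
  show ?thesis
    using cinner_eqI_norm_cnj[of "J x" "J y" 1 x y] norm[OF xy(1)] norm[OF xy(2)] by (simp add: 1 2)
qed

lemma hlinear_isometry_cinner:
  assumes S: "hclosed_subspace S" and A: "hlinear_on S A" "\<forall>x\<in>S. cnorm (A x) = cnorm x"
    and xy: "x \<in> S" "y \<in> S"
  shows "cinner (A x) (A y) = cinner x y"
proof -
  have 1: "A x + A y = A (x + y)"
    using A xy by (simp add: hlinear_on_def)
  have 2: "A x + \<i> *\<^sub>C A y = A (x + \<i> *\<^sub>C y)"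
    using A xy hclosed_scaleC[OF S xy(2)] by (simp add: hlinear_on_def)
  have n: "cnorm (A x + A y) = cnorm (x + y)" "cnorm (A x + \<i> *\<^sub>C A y) = cnorm (x + \<i> *\<^sub>C y)"
    using A hclosed_add[OF S] hclosed_scaleC[OF S] xy by (simp_all add: 1 2)
  show ?thesis
    using cinner_eqI_norm[of "A x" "A y" 1 x y] A xy by (simp add: n)
qed

text \<open>The difference of two isometries is controlled by twice the distance, and both are
  determined on the finite partial sums.\<close>
lemma antilinear_isometry_eqI:
  assumes S: "hclosed_subspace S" and b: "onb_seq S b"
    and A: "\<And>x y. x \<in> S \<Longrightarrow> y \<in> S \<Longrightarrow> A (x + y) = A x + A y"
      "\<And>c x. x \<in> S \<Longrightarrow> A (c *\<^sub>C x) = cnj c *\<^sub>C A x" "\<And>x. x \<in> S \<Longrightarrow> cnorm (A x) = cnorm x"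
    and B: "\<And>x y. x \<in> S \<Longrightarrow> y \<in> S \<Longrightarrow> B (x + y) = B x + B y"
      "\<And>c x. x \<in> S \<Longrightarrow> B (c *\<^sub>C x) = cnj c *\<^sub>C B x" "\<And>x. x \<in> S \<Longrightarrow> cnorm (B x) = cnorm x"
    and eq: "\<And>k. A (b k) = B (b k)" and w: "w \<in> S"
  shows "A w = B w"
proof -
  have bS: "b k \<in> S" for k
    using b by (auto simp: onb_seq_def)
  let ?p = "hpart (\<lambda>k. cinner (b k) w) b"
  have p: "?p n \<in> S" for n
    by (auto simp: hpart_def intro!: hclosed_sum hclosed_scaleC S bS)
  have lim: "hlim ?p w"
    using b w by (auto simp: onb_seq_def)
  have "A 0 = 0" "B 0 = 0"
    using A(2)[of 0 0] B(2)[of 0 0] hclosed_zero[OF S] by auto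
  then have "A (?p n) = B (?p n)" for n
  proof (induction n)
    case (Suc n)
    then show ?case
      using p[of n] A(1)[OF p[of n] hclosed_scaleC[OF S bS]] B(1)[OF p[of n] hclosed_scaleC[OF S bS]]
      by (simp add: hpart_def A(2) B(2) bS eq)
  qed (simp add: hpart_def)
  moreover have "hlim (\<lambda>n. T (?p n)) (T w)"
    if T: "\<And>x y. x \<in> S \<Longrightarrow> y \<in> S \<Longrightarrow> T (x + y) = T x + T y" "\<And>x. x \<in> S \<Longrightarrow> cnorm (T x) = cnorm x" for T
  proof -
    have "T (?p n) - T w = T (?p n - w)" for n
      using T(1)[OF hclosed_diff[OF S p w] w, of n] by simp
    then show ?thesis
      using lim T(2) hclosed_diff[OF S p w] by (simp add: hlim_def)
  qed
  ultimately show ?thesis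
    using hlim_unique A(1,3) B(1,3) by (metis (no_types, lifting) hlim_cong_0)
qed

text \<open>By Bessel's identity the squared distance of z to the n-th partial sum is
  the tail of a series whose total is the squared norm of z.\<close>
lemma hsum_eqI:
  fixes d :: "nat \<Rightarrow> 'a::chilbert"
  assumes S: "hclosed_subspace S" and b: "onb_seq S b" and d: "\<And>k. d k \<in> S"
    and iso: "\<And>i j. cinner (d i) (d j) = cinner (b i) (b j)"
    and y: "y \<in> S" and coeff: "\<And>k. cinner (d k) z = cinner (b k) y" and norm: "(cnorm z)\<^sup>2 = (cnorm y)\<^sup>2"
  shows "hsum (\<lambda>k. cinner (b k) y) d = z"
proof -
  have od: "orthoseq d"
    using b iso by (auto simp: onb_seq_def intro: orthoseq_cong)
  let ?p = "hpart (\<lambda>k. cinner (b k) y) d"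
  have "(\<lambda>n. (cnorm (?p n))\<^sup>2) \<longlonglongrightarrow> (cnorm (hsum (\<lambda>k. cinner (b k) y) d))\<^sup>2"
    by (intro tendsto_power hlim_cnorm hlim_hsum[OF od summable_coeff[OF b y]])
  also have "cnorm (hsum (\<lambda>k. cinner (b k) y) d) = cnorm y"
    using onb_map_isometry(2)[OF S b d iso] y by blast
  finally have lim: "(\<lambda>n. (cnorm (?p n))\<^sup>2) \<longlonglongrightarrow> (cnorm y)\<^sup>2" .
  have "(cnorm (?p n - z))\<^sup>2 = (cnorm y)\<^sup>2 - (cnorm (?p n))\<^sup>2" for n
    using bessel[OF od, of z n] by (simp add: coeff norm)
  then have "(\<lambda>n. (cnorm (?p n - z))\<^sup>2) \<longlonglongrightarrow> 0"
    using tendsto_diff[OF tendsto_const[of "(cnorm y)\<^sup>2"] lim] by simp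
  then have "(\<lambda>n. sqrt ((cnorm (?p n - z))\<^sup>2)) \<longlonglongrightarrow> sqrt 0"
    by (rule tendsto_real_sqrt)
  then have "hlim ?p z"
    by (simp add: hlim_def)
  then show ?thesis
    by (rule hsumI)
qed

section \<open>Measures on the circle\<close>

lemma sets_circle: "circle_borel M \<Longrightarrow> sets M = sets (restrict_space borel (sphere 0 1))"
  by (simp add: circle_borel_def)

lemma space_circle: "circle_borel M \<Longrightarrow> space M = sphere 0 1"
  using sets_eq_imp_space_eq[OF sets_circle] by (simp add: space_restrict_space)

lemma measurable_circle_continuous:
  fixes f :: "complex \<Rightarrow> 'b::topological_space"
  assumes "circle_borel M" "continuous_on (sphere 0 1) f"
  shows "f \<in> borel_measurable M"
  using borel_measurable_continuous_on_restrict[OF assms(2)]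
  by (simp add: measurable_cong_sets[OF sets_circle[OF assms(1)] refl])

lemma integrable_circle_continuous:
  fixes f :: "complex \<Rightarrow> 'b::{second_countable_topology, banach}"
  assumes "circle_borel M" "finite_measure M" "continuous_on (sphere 0 1) f"
  shows "integrable M f"
proof -
  have "compact (f ` sphere 0 1)"
    by (intro compact_continuous_image assms) simp
  then have "bounded (f ` sphere 0 1)"
    by (rule compact_imp_bounded)
  then obtain B where B: "\<forall>y\<in>f ` sphere 0 1. norm y \<le> B"
    unfolding bounded_iff by blast
  show ?thesis
  proof (rule finite_measure.integrable_const_bound[OF assms(2)])
    show "AE \<xi> in M. norm (f \<xi>) \<le> B"
      using B by (intro AE_I2) (simp only: space_circle[OF assms(1)] ball_simps)
  qed (rule measurable_circle_continuous[OF assms(1,3)])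
qed

section \<open>Finite measures on the circle are determined by their moments\<close>

text \<open>On the circle these are the Laurent polynomials. Keeping the powers of
  \<open>\<xi>\<close> and \<open>cnj \<xi>\<close> separate makes closure under products a formal
  computation on the whole plane; they are cancelled only under the integral.\<close>

inductive trig_poly :: "(complex \<Rightarrow> complex) \<Rightarrow> bool" where
  mono: "trig_poly (\<lambda>\<xi>. c * \<xi> ^ j * cnj \<xi> ^ k)"
| add: "trig_poly p \<Longrightarrow> trig_poly q \<Longrightarrow> trig_poly (\<lambda>\<xi>. p \<xi> + q \<xi>)"

lemma trig_poly_mult:
  assumes "trig_poly p" "trig_poly q"
  shows "trig_poly (\<lambda>\<xi>. p \<xi> * q \<xi>)"
  using assms
proof (induction p rule: trig_poly.induct)
  case (mono c j k)
  from \<open>trig_poly q\<close> show ?case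
  proof (induction q rule: trig_poly.induct)
    case (mono d l m)
    have "(\<lambda>\<xi>. c * \<xi> ^ j * cnj \<xi> ^ k * (d * \<xi> ^ l * cnj \<xi> ^ m)) =
        (\<lambda>\<xi>. (c * d) * \<xi> ^ (j + l) * cnj \<xi> ^ (k + m))"
      by (simp add: power_add mult_ac)
    then show ?case
      using trig_poly.mono[of "c * d" "j + l" "k + m"] by simp
  next
    case (add p q)
    then show ?case
      using trig_poly.add by (simp add: distrib_left)
  qed
next
  case (add p1 p2)
  then show ?case
    using trig_poly.add by (simp add: distrib_right)
qed

lemma trig_poly_real_polynomial:
  assumes "real_polynomial_function p"
  shows "trig_poly (\<lambda>\<xi>. complex_of_real (p \<xi>))"
  using assms
proof (induction p rule: real_polynomial_function.induct)
  case (linear f)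
  let ?a = "complex_of_real (f 1)" and ?b = "complex_of_real (f \<i>)"
  have f: "f \<xi> = Re \<xi> * f 1 + Im \<xi> * f \<i>" for \<xi>
  proof -
    interpret bounded_linear f by (rule linear)
    have eq: "\<xi> = Re \<xi> *\<^sub>R 1 + Im \<xi> *\<^sub>R \<i>"
      by (simp add: complex_eq_iff)
    show ?thesis
      by (subst eq) (simp only: add scaleR real_scaleR_def)
  qed
  \<comment> \<open>The coefficients result from writing Re \<xi> and Im \<xi> through \<xi> and its
    conjugate.\<close>
  have "(\<lambda>\<xi>. complex_of_real (f \<xi>)) =
      (\<lambda>\<xi>. ((?a - \<i> * ?b) / 2) * \<xi> ^ 1 * cnj \<xi> ^ 0 + ((?a + \<i> * ?b) / 2) * \<xi> ^ 0 * cnj \<xi> ^ 1)"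
  proof (rule ext)
    fix \<xi>
    show "complex_of_real (f \<xi>) = ((?a - \<i> * ?b) / 2) * \<xi> ^ 1 * cnj \<xi> ^ 0 +
        ((?a + \<i> * ?b) / 2) * \<xi> ^ 0 * cnj \<xi> ^ 1"
      by (subst f[of \<xi>]) (simp add: complex_eq_iff field_simps)
  qed
  then show ?case
    by (simp only:) (intro trig_poly.add trig_poly.mono)
next
  case (const c)
  then show ?case
    using trig_poly.mono[of "complex_of_real c" 0 0] by simp
qed (auto intro: trig_poly.add trig_poly_mult)

lemma continuous_on_trig_poly: "trig_poly p \<Longrightarrow> continuous_on S p"
  by (induction rule: trig_poly.induct) (auto intro!: continuous_intros)

lemma integral_trig_poly_eq:
  assumes M: "circle_borel M" "finite_measure M" and N: "circle_borel N" "finite_measure N"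
    and moments: "\<And>k. (\<integral>\<xi>. \<xi> ^ k \<partial>M) = (\<integral>\<xi>. \<xi> ^ k \<partial>N)"
    and "trig_poly p"
  shows "(\<integral>\<xi>. p \<xi> \<partial>M) = (\<integral>\<xi>. p \<xi> \<partial>N)"
  using \<open>trig_poly p\<close>
proof (induction p rule: trig_poly.induct)
  case (mono c j k)
  \<comment> \<open>Since \<xi> times its conjugate is 1 on the circle, only one kind of power
    remains. A power of \<open>cnj \<xi>\<close> integrates to the conjugate of a moment, so
    nonnegative exponents are enough.\<close>
  define q where "q \<xi> = (if k \<le> j then \<xi> ^ (j - k) else cnj (\<xi> ^ (k - j)))" for \<xi> :: complex
  have eq: "c * \<xi> ^ j * cnj \<xi> ^ k = c * q \<xi>" if "\<xi> \<in> sphere 0 1" for \<xi> :: complex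
  proof -
    have 1: "\<xi> ^ n * cnj \<xi> ^ n = 1" for n
      using that by (simp add: power_mult_distrib[symmetric] complex_norm_square[symmetric])
    show ?thesis
    proof (cases "k \<le> j")
      case True
      then have "\<xi> ^ j = \<xi> ^ (j - k) * \<xi> ^ k"
        by (simp add: power_add[symmetric])
      then show ?thesis
        using 1[of k] True by (simp add: q_def mult.assoc)
    next
      case False
      then have "cnj \<xi> ^ k = cnj \<xi> ^ j * cnj \<xi> ^ (k - j)"
        by (simp add: power_add[symmetric])
      then show ?thesis
        using 1[of j] False by (simp add: q_def mult.assoc[symmetric])
    qed
  qed
  have int: "(\<integral>\<xi>. c * \<xi> ^ j * cnj \<xi> ^ k \<partial>L) = c * (\<integral>\<xi>. q \<xi> \<partial>L)" if L: "circle_borel L" for L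
    using eq by (subst Bochner_Integration.integral_cong[OF refl, of _ _ "\<lambda>\<xi>. c * q \<xi>"])
      (simp_all add: space_circle[OF L])
  have "(\<integral>\<xi>. q \<xi> \<partial>M) = (\<integral>\<xi>. q \<xi> \<partial>N)"
    by (cases "k \<le> j") (simp_all add: q_def moments del: complex_cnj_power)
  then show ?case
    by (simp add: int M N)
next
  case (add p q)
  then show ?case
    by (simp add: integrable_circle_continuous[OF M continuous_on_trig_poly]
        integrable_circle_continuous[OF N continuous_on_trig_poly])
qed

text \<open>Stone-Weierstrass approximates \<open>f\<close> uniformly within \<open>e\<close> by a
  polynomial whose two integrals agree; each replacement costs at most \<open>e\<close> times a
  total mass, which is finite.\<close>

lemma integral_continuous_eq:
  fixes f :: "complex \<Rightarrow> real"
  assumes M: "circle_borel M" "finite_measure M" and N: "circle_borel N" "finite_measure N"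
    and moments: "\<And>k. (\<integral>\<xi>. \<xi> ^ k \<partial>M) = (\<integral>\<xi>. \<xi> ^ k \<partial>N)"
    and f: "continuous_on (sphere 0 1) f"
  shows "(\<integral>\<xi>. f \<xi> \<partial>M) = (\<integral>\<xi>. f \<xi> \<partial>N)"
proof -
  let ?K = "measure M (space M) + measure N (space N)"
  have approx: "\<bar>(\<integral>\<xi>. f \<xi> \<partial>L) - (\<integral>\<xi>. p \<xi> \<partial>L)\<bar> \<le> e * measure L (space L)"
    if L: "circle_borel L" "finite_measure L" and p: "continuous_on (sphere 0 1) p"
      and e: "\<And>\<xi>. \<xi> \<in> sphere 0 1 \<Longrightarrow> \<bar>f \<xi> - p \<xi>\<bar> \<le> e" for L p e
  proof -
    interpret finite_measure L by fact
    note int = integrable_circle_continuous[OF L f] integrable_circle_continuous[OF L p]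
    have "\<bar>\<integral>\<xi>. f \<xi> - p \<xi> \<partial>L\<bar> \<le> (\<integral>\<xi>. \<bar>f \<xi> - p \<xi>\<bar> \<partial>L)"
      by (rule integral_abs_bound)
    also have "\<dots> \<le> (\<integral>\<xi>. e \<partial>L)"
      using int by (intro integral_mono) (auto simp: e space_circle[OF L(1)])
    finally show ?thesis
      using int by (simp add: mult.commute)
  qed
  have "\<bar>(\<integral>\<xi>. f \<xi> \<partial>M) - (\<integral>\<xi>. f \<xi> \<partial>N)\<bar> \<le> e * ?K" if "e > 0" for e
  proof -
    obtain p where p: "polynomial_function p" "\<And>\<xi>. \<xi> \<in> sphere 0 1 \<Longrightarrow> norm (f \<xi> - p \<xi>) < e"
      using Stone_Weierstrass_polynomial_function[OF _ f \<open>e > 0\<close>] by auto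
    then have pp: "real_polynomial_function p"
      by (simp add: real_polynomial_function_eq)
    have cont: "continuous_on (sphere 0 1) p"
      using p(1) by (rule continuous_on_polymonial_function)
    have "(\<integral>\<xi>. complex_of_real (p \<xi>) \<partial>M) = (\<integral>\<xi>. complex_of_real (p \<xi>) \<partial>N)"
      by (rule integral_trig_poly_eq[OF M N moments trig_poly_real_polynomial[OF pp]])
    then have eq: "(\<integral>\<xi>. p \<xi> \<partial>M) = (\<integral>\<xi>. p \<xi> \<partial>N)"
      by (simp add: integral_complex_of_real)
    have "\<bar>f \<xi> - p \<xi>\<bar> \<le> e" if "\<xi> \<in> sphere 0 1" for \<xi>
      using p(2)[OF that] by simp
    from approx[OF M cont this] approx[OF N cont this] show ?thesis
      by (simp add: eq distrib_left abs_le_iff)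
  qed
  then have *: "\<bar>(\<integral>\<xi>. f \<xi> \<partial>M) - (\<integral>\<xi>. f \<xi> \<partial>N)\<bar> \<le> 0 + e" if "e > 0" for e
  proof -
    \<comment> \<open>The added 1 keeps the denominator positive even if both measures
      vanish.\<close>
    have K: "?K + 1 > 0"
      by (simp add: add_nonneg_pos)
    then have "\<bar>(\<integral>\<xi>. f \<xi> \<partial>M) - (\<integral>\<xi>. f \<xi> \<partial>N)\<bar> \<le> (e / (?K + 1)) * ?K"
      using that \<open>\<And>e. e > 0 \<Longrightarrow> _\<close> by (metis divide_pos_pos)
    also have "\<dots> \<le> e"
      using that K by (simp add: field_simps)
    finally show ?thesis by simp
  qed
  have "\<bar>(\<integral>\<xi>. f \<xi> \<partial>M) - (\<integral>\<xi>. f \<xi> \<partial>N)\<bar> \<le> 0"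
    by (rule field_le_epsilon) (rule *)
  then show ?thesis
    by simp
qed

text \<open>The sphere is closed, so its relatively closed subsets are closed in the plane. They
  form an intersection-stable generator on which two measures can be compared.\<close>

lemma sets_circle_closed:
  "sets (restrict_space borel (sphere (0::complex) 1)) = sigma_sets (sphere 0 1) {A. closed A \<and> A \<subseteq> sphere 0 1}"
proof -
  have "(\<inter>) (sphere (0::complex) 1) ` {A. closed A} = {A. closed A \<and> A \<subseteq> sphere 0 1}"
    by (auto simp: image_iff intro: exI[of _ "_ :: complex set"])
  moreover have "sets (restrict_space borel (sphere (0::complex) 1)) =
      (\<inter>) (sphere 0 1) ` sigma_sets UNIV {A. closed A}"
    by (simp add: sets_restrict_space borel_eq_closed)
  ultimately show ?thesis
    using sigma_sets_Int[of "sphere (0::complex) 1" UNIV "{A. closed A}"]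
    by (metis borel_closed borel_eq_closed closed_sphere sets_measure_of top.extremum top_greatest Pow_UNIV)
qed

text \<open>The indicator of a closed set is a bounded pointwise limit of continuous functions, so
  dominated convergence carries equality of integrals over to closed sets, and these generate the
  Borel sets.\<close>

theorem circle_measure_eqI:
  assumes M: "circle_borel M" "finite_measure M" and N: "circle_borel N" "finite_measure N"
    and moments: "\<And>k. (\<integral>\<xi>. \<xi> ^ k \<partial>M) = (\<integral>\<xi>. \<xi> ^ k \<partial>N)"
  shows "M = N"
proof (rule measure_eqI_generator_eq[where E = "{A. closed A \<and> A \<subseteq> sphere 0 1}" and A = "\<lambda>_. sphere 0 1"])
  show "sets M = sigma_sets (sphere 0 1) {A. closed A \<and> A \<subseteq> sphere 0 1}"
    "sets N = sigma_sets (sphere 0 1) {A. closed A \<and> A \<subseteq> sphere 0 1}"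
    by (simp_all add: sets_circle M N sets_circle_closed)
  fix A :: "complex set" assume "A \<in> {A. closed A \<and> A \<subseteq> sphere 0 1}"
  then have A: "closed A" "A \<subseteq> sphere 0 1"
    by auto
  show "emeasure M A = emeasure N A"
  \<comment> \<open>The empty set is separated because \<open>infdist\<close> to it is 0, so the
    approximants would all be 1.\<close>
  proof (cases "A = {}")
    case False
    \<comment> \<open>A tent around \<open>A\<close>: it is 1 on \<open>A\<close> and falls linearly
      to 0 at distance 1/n.\<close>
    define f where "f n \<xi> = max 0 (1 - real n * infdist \<xi> A)" for n \<xi>
    have lim: "(\<lambda>n. f n \<xi>) \<longlonglongrightarrow> indicat_real A \<xi>" for \<xi>
    proof (cases "\<xi> \<in> A")
      case True
      then show ?thesis by (simp add: f_def)
    next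
      case False
      then have d: "infdist \<xi> A > 0"
        using A(1) \<open>A \<noteq> {}\<close> by (metis in_closed_iff_infdist_zero infdist_nonneg less_eq_real_def)
      obtain k where k: "real k * infdist \<xi> A > 1"
        using d reals_Archimedean3 by blast
      have "f n \<xi> = 0" if "n \<ge> k" for n
      proof -
        have "real n * infdist \<xi> A \<ge> real k * infdist \<xi> A"
          using that d by (intro mult_right_mono) auto
        then show ?thesis
          using k by (simp add: f_def)
      qed
      then have "\<forall>\<^sub>F n in sequentially. f n \<xi> = 0"
        by (auto simp: eventually_sequentially)
      then show ?thesis
        using False by (simp add: tendsto_eventually)
    qed
    have le_1: "norm (f n \<xi>) \<le> 1" for n \<xi>
      using mult_nonneg_nonneg[OF of_nat_0_le_iff infdist_nonneg, of n \<xi> A] by (simp add: f_def)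
    have cont: "continuous_on (sphere 0 1) (f n)" for n
      unfolding f_def by (intro continuous_intros)
    have "(\<lambda>n. \<integral>\<xi>. f n \<xi> \<partial>L) \<longlonglongrightarrow> measure L A" if L: "circle_borel L" "finite_measure L" for L
    proof -
      interpret finite_measure L by fact
      have AL: "A \<in> sets L"
        using A by (simp add: sets_circle[OF L(1)] sets_restrict_space_iff)
      have "(\<lambda>n. \<integral>\<xi>. f n \<xi> \<partial>L) \<longlonglongrightarrow> (\<integral>\<xi>. indicat_real A \<xi> \<partial>L)"
      proof (rule integral_dominated_convergence[where w = "\<lambda>_. 1"])
        show "f n \<in> borel_measurable L" for n
          by (rule measurable_circle_continuous[OF L(1) cont])
        show "AE \<xi> in L. norm (f n \<xi>) \<le> 1" for n
          using le_1 by (intro AE_I2)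
      qed (use lim AL in simp_all)
      then show ?thesis
        using AL by (simp add: Int_absorb2 sets.sets_into_space)
    qed
    from this[OF M] this[OF N] have "measure M A = measure N A"
      using integral_continuous_eq[OF M N moments cont] LIMSEQ_unique by simp
    then show ?thesis
      using M(2) N(2) by (simp add: finite_measure.emeasure_eq_measure)
  qed simp
next
  show "emeasure M (sphere 0 1) \<noteq> \<infinity>"
    using M(2) by (simp add: finite_measure.emeasure_eq_measure)
qed (auto simp: Int_stable_def)

section \<open>Countable sums of measures\<close>

definition sum_measure :: "(nat \<Rightarrow> 'a measure) \<Rightarrow> 'a measure" where
  "sum_measure M = measure_of (space (M 0)) (sets (M 0)) (\<lambda>A. \<Sum>n. emeasure (M n) A)"

lemma sets_sum_measure [simp]: "sets (sum_measure M) = sets (M 0)"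
  and space_sum_measure [simp]: "space (sum_measure M) = space (M 0)"
  by (simp_all add: sum_measure_def)

lemma emeasure_sum_measure:
  assumes "\<And>n. sets (M n) = sets (M 0)" "A \<in> sets (M 0)"
  shows "emeasure (sum_measure M) A = (\<Sum>n. emeasure (M n) A)"
proof (rule emeasure_measure_of[OF sum_measure_def])
  show "countably_additive (sets (sum_measure M)) (\<lambda>A. \<Sum>n. emeasure (M n) A)"
    unfolding countably_additive_def
  proof (intro allI impI)
    fix F :: "nat \<Rightarrow> 'a set"
    assume F: "range F \<subseteq> sets (sum_measure M)" "disjoint_family F"
    \<comment> \<open>Reading the outer series as an integral over counting measure lets
      \<open>nn_integral_suminf\<close> interchange the two sums.\<close>
    have "(\<Sum>i. \<Sum>n. emeasure (M n) (F i)) = (\<integral>\<^sup>+i. (\<Sum>n. emeasure (M n) (F i)) \<partial>count_space UNIV)"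
      by (simp only: nn_integral_count_space_nat)
    also have "\<dots> = (\<Sum>n. \<integral>\<^sup>+i. emeasure (M n) (F i) \<partial>count_space UNIV)"
      by (rule nn_integral_suminf) simp
    also have "\<dots> = (\<Sum>n. \<Sum>i. emeasure (M n) (F i))"
      by (simp only: nn_integral_count_space_nat)
    also have "\<dots> = (\<Sum>n. emeasure (M n) (\<Union>i. F i))"
      using F assms(1) by (intro suminf_cong suminf_emeasure) auto
    finally show "(\<Sum>i. \<Sum>n. emeasure (M n) (F i)) = (\<Sum>n. emeasure (M n) (\<Union> (range F)))" .
  qed
  show "sets (M 0) \<subseteq> Pow (space (M 0))"
    by (rule sets.space_closed)
qed (use assms in \<open>simp_all add: positive_def\<close>)

lemma nn_integral_sum_measure:
  assumes sets: "\<And>n. sets (M n) = sets (M 0)" and f: "f \<in> borel_measurable (M 0)"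
  shows "(\<integral>\<^sup>+x. f x \<partial>sum_measure M) = (\<Sum>n. \<integral>\<^sup>+x. f x \<partial>M n)"
proof -
  have f': "f \<in> borel_measurable (sum_measure M)"
    using f by (simp add: measurable_cong_sets[OF sets_sum_measure refl])
  have meas: "g \<in> borel_measurable (M n)" if "g \<in> borel_measurable (sum_measure M)" for g n
    using that by (simp add: measurable_cong_sets[OF sets_sum_measure refl]
        measurable_cong_sets[OF sets[of n] refl])
  have sp: "space (M n) = space (M 0)" for n
    by (rule sets_eq_imp_space_eq[OF sets])
  show ?thesis
    using f'
  proof (induction f rule: borel_measurable_induct)
    case (cong f g)
    have "(\<integral>\<^sup>+x. f x \<partial>sum_measure M) = (\<integral>\<^sup>+x. g x \<partial>sum_measure M)"
      using cong(3) by (rule nn_integral_cong)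
    moreover have "(\<integral>\<^sup>+x. f x \<partial>M n) = (\<integral>\<^sup>+x. g x \<partial>M n)" for n
      using cong(3) by (intro nn_integral_cong) (simp add: sp[of n])
    ultimately show ?case
      using cong(4) by simp
  next
    case (set A)
    have A: "A \<in> sets (M n)" for n
      using set sets[of n] by simp
    then show ?case
      using emeasure_sum_measure[of M A, OF sets A[of 0]] set by simp
  next
    case (mult u c)
    then show ?case
      by (simp add: nn_integral_cmult meas)
  next
    case (add u v)
    then show ?case
      by (simp add: nn_integral_add meas suminf_add)
  next
    case (seq G)
    have SUP: "(\<integral>\<^sup>+x. (SUP i. G i) x \<partial>L) = (SUP i. \<integral>\<^sup>+x. G i x \<partial>L)"
      if "\<And>i. G i \<in> borel_measurable L" for L :: "'a measure"
      using nn_integral_monotone_convergence_SUP[OF seq(3) that] by (simp add: image_comp)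
    have "incseq (\<lambda>i. \<integral>\<^sup>+x. G i x \<partial>M n)" for n
      using seq(3) by (auto simp: incseq_def le_fun_def intro!: nn_integral_mono)
    then have "(\<Sum>n. SUP i. \<integral>\<^sup>+x. G i x \<partial>M n) = (SUP i. \<Sum>n. \<integral>\<^sup>+x. G i x \<partial>M n)"
      by (rule ennreal_suminf_SUP_eq)
    then show ?case
      by (simp only: SUP[OF seq(1)] SUP[OF meas[OF seq(1)]] seq(5))
  qed
qed

section \<open>Reflection of the circle and its density\<close>

lemma circle_borel_restrict: "circle_borel (restrict_space borel (sphere 0 1))"
  by (simp add: circle_borel_def)

lemma measurable_cnj_circle: "circle_borel M \<Longrightarrow> circle_borel N \<Longrightarrow> cnj \<in> M \<rightarrow>\<^sub>M N"
proof -
  assume M: "circle_borel M" and N: "circle_borel N"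
  have "cnj \<in> restrict_space borel (sphere 0 1) \<rightarrow>\<^sub>M restrict_space borel (sphere 0 1)"
    by (rule measurable_restrict_space3) (auto intro!: borel_measurable_continuous_onI continuous_intros)
  then show ?thesis
    by (simp only: measurable_cong_sets[OF sets_circle[OF M] sets_circle[OF N]])
qed

lemma sets_conj_measure [simp]: "sets (conj_measure M) = sets M"
  and space_conj_measure [simp]: "space (conj_measure M) = space M"
  by (simp_all add: conj_measure_def)

lemma circle_borel_conj_measure: "circle_borel M \<Longrightarrow> circle_borel (conj_measure M)"
  by (simp add: circle_borel_def)

lemma finite_measure_conj_measure:
  "circle_borel M \<Longrightarrow> finite_measure M \<Longrightarrow> finite_measure (conj_measure M)"
  unfolding conj_measure_def by (rule finite_measure.finite_measure_distr) (auto intro: measurable_cnj_circle)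

lemma nn_integral_conj_measure:
  "circle_borel M \<Longrightarrow> g \<in> borel_measurable M \<Longrightarrow> (\<integral>\<^sup>+\<xi>. g \<xi> \<partial>conj_measure M) = (\<integral>\<^sup>+\<xi>. g (cnj \<xi>) \<partial>M)"
  unfolding conj_measure_def by (rule nn_integral_distr) (auto intro: measurable_cnj_circle)

text \<open>On the circle the test function equals 1 + |c|^2 + 2 Re(c \<xi>^k), so it sees every
  moment while staying nonnegative. For a spectral measure its integral is the squared norm of x + c
  U^k x, the quantity that is preserved by \<open>C\<close> up to conjugating c.\<close>

lemma circle_measure_eqI_quadratic:
  assumes M: "circle_borel M" "finite_measure M" and N: "circle_borel N" "finite_measure N"
    and eq: "\<And>c k. (\<integral>\<^sup>+\<xi>. ennreal ((cmod (1 + c * \<xi> ^ k))\<^sup>2) \<partial>M) = (\<integral>\<^sup>+\<xi>. ennreal ((cmod (1 + c * \<xi> ^ k))\<^sup>2) \<partial>N)"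
  shows "M = N"
proof -
  define q where "q c k \<xi> = (cmod (1 + c * \<xi> ^ k))\<^sup>2" for c k \<xi>
  have q: "q c k \<xi> = 1 + (cmod c)\<^sup>2 + 2 * Re (c * \<xi> ^ k)" if "\<xi> \<in> sphere 0 1" for c k \<xi>
  proof -
    have "cmod (c * \<xi> ^ k) = cmod c"
      using that by (simp add: norm_mult norm_power)
    moreover have "(cmod (1 + z))\<^sup>2 = 1 + (cmod z)\<^sup>2 + 2 * Re z" for z
      unfolding cmod_power2 by (simp add: power2_eq_square algebra_simps)
    ultimately show ?thesis
      by (simp add: q_def)
  qed
  have int: "(\<integral>\<xi>. q c k \<xi> \<partial>L) = (1 + (cmod c)\<^sup>2) * measure L (space L) + 2 * Re (c * (\<integral>\<xi>. \<xi> ^ k \<partial>L))"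
    if L: "circle_borel L" "finite_measure L" for L c k
  proof -
    interpret finite_measure L by fact
    have affine: "(\<integral>\<xi>. a + 2 * Re (w \<xi>) \<partial>L) = a * measure L (space L) + 2 * Re (\<integral>\<xi>. w \<xi> \<partial>L)"
      if "integrable L w" for a w
      using that by (simp add: integrable_Re mult.commute)
    have i: "integrable L (\<lambda>\<xi>. c * \<xi> ^ k)"
      by (rule integrable_circle_continuous[OF L]) (intro continuous_intros)
    have "(\<integral>\<xi>. q c k \<xi> \<partial>L) = (\<integral>\<xi>. (1 + (cmod c)\<^sup>2) + 2 * Re (c * \<xi> ^ k) \<partial>L)"
      by (rule Bochner_Integration.integral_cong) (simp_all add: q space_circle[OF L(1)])
    also have "\<dots> = (1 + (cmod c)\<^sup>2) * measure L (space L) + 2 * Re (\<integral>\<xi>. c * \<xi> ^ k \<partial>L)"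
      using i by (rule affine)
    finally show ?thesis
      by simp
  qed
  have eq': "(\<integral>\<xi>. q c k \<xi> \<partial>M) = (\<integral>\<xi>. q c k \<xi> \<partial>N)" for c k
  proof -
    have "(\<integral>\<xi>. q c k \<xi> \<partial>L) = enn2real (\<integral>\<^sup>+\<xi>. ennreal ((cmod (1 + c * \<xi> ^ k))\<^sup>2) \<partial>L)"
      if L: "circle_borel L" for L
      unfolding q_def
      by (rule integral_eq_nn_integral) (auto intro!: measurable_circle_continuous[OF L] continuous_intros)
    from this[OF M(1)] this[OF N(1)] show ?thesis
      by (simp only: eq)
  qed
  \<comment> \<open>\<open>c = 0\<close> isolates the total mass; once that is known,
    \<open>c = 1\<close> and \<open>c = \<i>\<close> give the real part and minus the imaginary part
    of the k-th moment.\<close>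
  have mass: "measure M (space M) = measure N (space N)"
    using eq'[of 0 0] by (simp add: int[OF M] int[OF N])
  have "(\<integral>\<xi>. \<xi> ^ k \<partial>M) = (\<integral>\<xi>. \<xi> ^ k \<partial>N)" for k
  proof (rule complex_eqI)
    show "Re (\<integral>\<xi>. \<xi> ^ k \<partial>M) = Re (\<integral>\<xi>. \<xi> ^ k \<partial>N)"
      using eq'[of 1 k] by (simp add: int[OF M] int[OF N] mass)
    show "Im (\<integral>\<xi>. \<xi> ^ k \<partial>M) = Im (\<integral>\<xi>. \<xi> ^ k \<partial>N)"
      using eq'[of "\<i>" k] by (simp add: int[OF M] int[OF N] mass)
  qed
  then show ?thesis
    by (rule circle_measure_eqI[OF M N])
qed

locale circle_ac = finite_measure M for M :: "complex measure" +
  assumes borel: "circle_borel M" and ac: "absolutely_continuous M (conj_measure M)"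
begin

lemmas space_M = space_circle[OF borel]

lemma cnj_space: "\<xi> \<in> space M \<Longrightarrow> cnj \<xi> \<in> space M"
  by (simp add: space_M)

lemma measurable_cnj: "cnj \<in> M \<rightarrow>\<^sub>M M"
  by (rule measurable_cnj_circle[OF borel borel])

text \<open>This is where absolute continuity acts: a null set of \<open>M\<close> is also null for
  the reflected measure, so its reflection is null for \<open>M\<close>.\<close>

lemma AE_cnj:
  assumes "AE \<xi> in M. P \<xi>"
  shows "AE \<xi> in M. P (cnj \<xi>)"
proof -
  have "AE \<xi> in conj_measure M. P \<xi>"
    by (rule absolutely_continuous_AE[OF _ ac assms]) simp
  then show ?thesis
    unfolding conj_measure_def by (rule AE_distrD[OF measurable_cnj])
qed

lemma measurable_hdens [measurable]: "hdens M \<in> borel_measurable M"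
  by (simp add: hdens_def)

lemma nn_integral_cnj:
  assumes "g \<in> borel_measurable M"
  shows "(\<integral>\<^sup>+\<xi>. g (cnj \<xi>) \<partial>M) = (\<integral>\<^sup>+\<xi>. hdens M \<xi> * g \<xi> \<partial>M)"
  using RN_deriv_nn_integral[OF ac _ assms] nn_integral_conj_measure[OF borel assms]
  by (simp add: hdens_def)

lemma nn_integral_hdens: "(\<integral>\<^sup>+\<xi>. hdens M \<xi> \<partial>M) < \<infinity>"
  using nn_integral_cnj[of "\<lambda>_. 1"] emeasure_finite[of "space M"] by (simp add: less_top)

text \<open>The density has finite integral, so the passage to real values in \<open>Jsharp\<close>
  loses nothing almost everywhere.\<close>

lemma AE_hdens_finite: "AE \<xi> in M. ennreal (enn2real (hdens M \<xi>)) = hdens M \<xi>"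
proof -
  have "AE \<xi> in M. hdens M \<xi> \<noteq> \<infinity>"
    using nn_integral_hdens by (intro nn_integral_PInf_AE) auto
  then show ?thesis
    by eventually_elim (simp add: less_top)
qed

end

text \<open>\<open>memL2\<close> demands only weak measurability; Parseval turns the squared norm
  into a countable series of measurable functions.\<close>

lemma measurable_cnorm_memL2:
  assumes f: "memL2 M S f" and b: "onb_seq S b"
  shows "(\<lambda>\<xi>. (cnorm (f \<xi>))\<^sup>2) \<in> borel_measurable M"
proof -
  have [measurable]: "(\<lambda>\<xi>. cinner v (f \<xi>)) \<in> borel_measurable M" for v
    using f by (simp add: memL2_def)
  have "(cnorm (f \<xi>))\<^sup>2 = (\<Sum>k. (cmod (cinner (b k) (f \<xi>)))\<^sup>2)" if "\<xi> \<in> space M" for \<xi>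
    using f that by (intro sums_unique parseval[OF b]) (simp add: memL2_def)
  moreover have "(\<lambda>\<xi>. \<Sum>k. (cmod (cinner (b k) (f \<xi>)))\<^sup>2) \<in> borel_measurable M"
    by measurable
  ultimately show ?thesis
    by (simp cong: measurable_cong)
qed

section \<open>The spectral representation and scalar spectral measures\<close>

locale spectral_rep =
  fixes U C :: "'h::chilbert \<Rightarrow> 'h"
    and \<mu> :: "nat \<Rightarrow> complex measure"
    and E :: "nat \<Rightarrow> 'e::chilbert set"
    and I :: "'h \<Rightarrow> nat \<Rightarrow> complex \<Rightarrow> 'e"
  assumes C_conj: "hconjugation C"
    and mu_borel: "\<And>n. circle_borel (\<mu> n)"
    and mu_finite: "\<And>n. finite_measure (\<mu> n)"
    and mu_sing: "\<And>m n. m \<noteq> n \<Longrightarrow> hmutually_singular (\<mu> m) (\<mu> n)"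
    and E_sub: "\<And>n. hclosed_subspace (E n)"
    and E_dim: "\<And>n. hilbert_dim (E n) (dimidx n)"
    and I_iso: "isometric_iso \<mu> E I"
    and I_U: "\<And>x. aeqH \<mu> (I (U x)) (\<lambda>n. mult_xi (I x n))"
    and mu_ac: "\<And>n. absolutely_continuous (\<mu> n) (conj_measure (\<mu> n))"
begin

lemma circle_ac_mu: "circle_ac (\<mu> n)"
  using mu_finite mu_borel mu_ac by (simp add: circle_ac_def circle_ac_axioms_def)

sublocale mu: circle_ac "\<mu> n" for n
  by (rule circle_ac_mu)

lemma memL2_I: "memL2 (\<mu> n) (E n) (I x n)"
  using I_iso by (simp add: isometric_iso_def memL2H_def)

lemma I_in: "\<xi> \<in> space (\<mu> n) \<Longrightarrow> I x n \<xi> \<in> E n"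
  using memL2_I by (simp add: memL2_def)

lemma I_add: "AE \<xi> in \<mu> n. I (x + y) n \<xi> = I x n \<xi> + I y n \<xi>"
  using I_iso by (simp add: isometric_iso_def aeqH_def)

lemma I_scaleC: "AE \<xi> in \<mu> n. I (c *\<^sub>C x) n \<xi> = c *\<^sub>C I x n \<xi>"
  using I_iso by (simp add: isometric_iso_def aeqH_def)

lemma I_mult: "AE \<xi> in \<mu> n. I (U x) n \<xi> = \<xi> *\<^sub>C I x n \<xi>"
  using I_U by (simp add: aeqH_def mult_xi_def)

lemma I_norm: "(\<Sum>n. \<integral>\<^sup>+\<xi>. ennreal ((cnorm (I x n \<xi>))\<^sup>2) \<partial>\<mu> n) = ennreal ((cnorm x)\<^sup>2)"
  using I_iso by (simp add: isometric_iso_def normsqL2H_def)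

lemma ex_onb: "\<exists>b. onb_seq (E n) b"
  using hilbert_dim_onb_seq[OF E_sub E_dim] by blast

lemma measurable_cnorm_I [measurable]: "(\<lambda>\<xi>. (cnorm (I x n \<xi>))\<^sup>2) \<in> borel_measurable (\<mu> n)"
  using ex_onb measurable_cnorm_memL2[OF memL2_I] by blast

lemma I_inj:
  assumes "\<And>n. AE \<xi> in \<mu> n. I x n \<xi> = I y n \<xi>"
  shows "x = y"
proof -
  have "AE \<xi> in \<mu> n. ennreal ((cnorm (I (x + (- 1) *\<^sub>C y) n \<xi>))\<^sup>2) = 0" for n
    using assms[of n] I_add[of x "(- 1) *\<^sub>C y" n] I_scaleC[of "- 1" y n]
    by eventually_elim (simp add: scaleC_minus_one)
  then have "(\<integral>\<^sup>+\<xi>. ennreal ((cnorm (I (x + (- 1) *\<^sub>C y) n \<xi>))\<^sup>2) \<partial>\<mu> n) = 0" for n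
    using nn_integral_cong_AE[of _ "\<lambda>_. 0" "\<mu> n"] by fastforce
  then have "ennreal ((cnorm (x + (- 1) *\<^sub>C y))\<^sup>2) = 0"
    by (simp flip: I_norm)
  then show ?thesis
    by (simp add: scaleC_minus_one)
qed

lemma C_add: "C (x + y) = C x + C y" and C_scaleC: "C (c *\<^sub>C x) = cnj c *\<^sub>C C x"
  and C_norm: "cnorm (C x) = cnorm x" and C_C: "C (C x) = x"
  using C_conj by (simp_all add: hconjugation_def)

lemma I_power: "AE \<xi> in \<mu> n. I ((U ^^ k) x) n \<xi> = \<xi> ^ k *\<^sub>C I x n \<xi>"
proof (induction k)
  case (Suc k)
  from Suc I_mult[of "(U ^^ k) x" n] show ?case
    by eventually_elim (simp add: scaleC_scaleC)
qed (simp add: scaleC_one)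

lemma I_poly:
  "AE \<xi> in \<mu> n. I (x + c *\<^sub>C (U ^^ k) x) n \<xi> = (1 + c * \<xi> ^ k) *\<^sub>C I x n \<xi>"
  using I_add[of x "c *\<^sub>C (U ^^ k) x" n] I_scaleC[of c "(U ^^ k) x" n] I_power[of k x n]
  by eventually_elim (simp add: scaleC_add_left scaleC_scaleC scaleC_one)

text \<open>The scalar spectral measure of \<open>U\<close> at \<open>x\<close>, assembled directly
  from the components of \<open>I x\<close> without a projection-valued measure. Its total mass is
  the squared norm of \<open>x\<close>.\<close>

definition spec_measure :: "'h \<Rightarrow> complex measure" where
  "spec_measure x = sum_measure (\<lambda>n. density (\<mu> n) (\<lambda>\<xi>. ennreal ((cnorm (I x n \<xi>))\<^sup>2)))"

lemma sets_mu: "sets (\<mu> n) = sets (restrict_space borel (sphere 0 1))"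
  using mu_borel by (rule sets_circle)

lemma sets_mu_eq: "sets (\<mu> n) = sets (\<mu> m)"
  by (simp only: sets_mu)

lemma circle_borel_spec: "circle_borel (spec_measure x)"
  using mu_borel by (simp add: circle_borel_def spec_measure_def)

lemma nn_integral_spec:
  assumes "g \<in> borel_measurable (restrict_space borel (sphere 0 1))"
  shows "(\<integral>\<^sup>+\<xi>. g \<xi> \<partial>spec_measure x) = (\<Sum>n. \<integral>\<^sup>+\<xi>. ennreal ((cnorm (I x n \<xi>))\<^sup>2) * g \<xi> \<partial>\<mu> n)"
proof -
  have g: "g \<in> borel_measurable (\<mu> n)" for n
    using assms by (simp only: measurable_cong_sets[OF sets_mu refl])
  have "(\<integral>\<^sup>+\<xi>. g \<xi> \<partial>spec_measure x) =
      (\<Sum>n. \<integral>\<^sup>+\<xi>. g \<xi> \<partial>density (\<mu> n) (\<lambda>\<xi>. ennreal ((cnorm (I x n \<xi>))\<^sup>2)))"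
    unfolding spec_measure_def
    by (rule nn_integral_sum_measure)
      (simp_all only: sets_density sets_mu measurable_cong_sets[OF sets_density refl] g)
  also have "\<dots> = (\<Sum>n. \<integral>\<^sup>+\<xi>. ennreal ((cnorm (I x n \<xi>))\<^sup>2) * g \<xi> \<partial>\<mu> n)"
    by (intro suminf_cong nn_integral_density g) measurable
  finally show ?thesis .
qed

lemma finite_spec: "finite_measure (spec_measure x)"
proof
  have "emeasure (spec_measure x) (space (spec_measure x)) = (\<integral>\<^sup>+\<xi>. 1 \<partial>spec_measure x)"
    by simp
  also have "\<dots> = ennreal ((cnorm x)\<^sup>2)"
    by (subst nn_integral_spec) (simp_all add: I_norm)
  finally show "emeasure (spec_measure x) (space (spec_measure x)) \<noteq> \<infinity>"
    by simp
qed

text \<open>\<open>I\<close> turns \<open>U ^^ k\<close> into multiplication by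
  \<open>\<xi> ^ k\<close>, so the integrand is the squared norm of the image of x + c U^k x, and
  \<open>I\<close> is isometric.\<close>

lemma spec_quadratic:
  "(\<integral>\<^sup>+\<xi>. ennreal ((cmod (1 + c * \<xi> ^ k))\<^sup>2) \<partial>spec_measure x) = ennreal ((cnorm (x + c *\<^sub>C (U ^^ k) x))\<^sup>2)"
proof -
  have "(\<lambda>\<xi>::complex. ennreal ((cmod (1 + c * \<xi> ^ k))\<^sup>2)) \<in> borel_measurable (restrict_space borel (sphere 0 1))"
    by (intro measurable_circle_continuous[OF circle_borel_restrict] continuous_on_ennreal continuous_intros)
  then have "(\<integral>\<^sup>+\<xi>. ennreal ((cmod (1 + c * \<xi> ^ k))\<^sup>2) \<partial>spec_measure x) =
      (\<Sum>n. \<integral>\<^sup>+\<xi>. ennreal ((cnorm (I x n \<xi>))\<^sup>2) * ennreal ((cmod (1 + c * \<xi> ^ k))\<^sup>2) \<partial>\<mu> n)"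
    by (rule nn_integral_spec)
  also have "\<dots> = (\<Sum>n. \<integral>\<^sup>+\<xi>. ennreal ((cnorm (I (x + c *\<^sub>C (U ^^ k) x) n \<xi>))\<^sup>2) \<partial>\<mu> n)"
  proof (intro suminf_cong nn_integral_cong_AE)
    fix n
    show "AE \<xi> in \<mu> n. ennreal ((cnorm (I x n \<xi>))\<^sup>2) * ennreal ((cmod (1 + c * \<xi> ^ k))\<^sup>2) =
        ennreal ((cnorm (I (x + c *\<^sub>C (U ^^ k) x) n \<xi>))\<^sup>2)"
      using I_poly[of x c k n]
      by eventually_elim (simp add: cnorm_scaleC power_mult_distrib ennreal_mult mult.commute)
  qed
  finally show ?thesis
    by (simp only: I_norm)
qed

text \<open>Mutual singularity with each single \<open>\<mu> m\<close> gives a set of full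
  \<open>\<mu> n\<close> measure that is \<open>\<mu> m\<close>-null; the intersection of these
  countably many sets serves all \<open>m\<close> at once.\<close>

lemma ex_support: "\<exists>A\<in>sets (\<mu> n). (AE \<xi> in \<mu> n. \<xi> \<in> A) \<and> (\<forall>m. m \<noteq> n \<longrightarrow> (AE \<xi> in \<mu> m. \<xi> \<notin> A))"
proof -
  have "\<exists>S. S \<in> sets (\<mu> m) \<and> emeasure (\<mu> m) S = 0 \<and> emeasure (\<mu> n) (space (\<mu> n) - S) = 0" if "m \<noteq> n" for m
    using mu_sing[OF that] by (auto simp: hmutually_singular_def)
  then obtain S where S: "\<And>m. m \<noteq> n \<Longrightarrow> S m \<in> sets (\<mu> m)" "\<And>m. m \<noteq> n \<Longrightarrow> emeasure (\<mu> m) (S m) = 0"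
    "\<And>m. m \<noteq> n \<Longrightarrow> emeasure (\<mu> n) (space (\<mu> n) - S m) = 0"
    by metis
  define T where "T m = (if m = n then space (\<mu> n) else S m)" for m
  have T: "T m \<in> sets (\<mu> n)" for m
    using S(1)[of m] sets_mu_eq[of m n] by (auto simp: T_def)
  have "AE \<xi> in \<mu> n. \<xi> \<in> T m" for m
  proof (cases "m = n")
    case False
    then have "space (\<mu> n) - T m \<in> null_sets (\<mu> n)"
      using S(3)[of m] T[of m] by (intro null_setsI) (auto simp: T_def)
    then show ?thesis
      by (rule AE_I') auto
  qed (simp add: T_def)
  then have "AE \<xi> in \<mu> n. \<forall>m. \<xi> \<in> T m"
    by (simp add: AE_all_countable)
  moreover have "AE \<xi> in \<mu> m. \<xi> \<notin> (\<Inter>m. T m)" if "m \<noteq> n" for m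
  proof -
    have "S m \<in> null_sets (\<mu> m)"
      using S(1,2)[OF that] by (rule null_setsI[rotated])
    then show ?thesis
      by (rule AE_I') (use that in \<open>auto simp: T_def split: if_splits\<close>)
  qed
  ultimately show ?thesis
    using T by (intro bexI[of _ "\<Inter>m. T m"]) (auto intro: sets.countable_INT'')
qed

section \<open>Pointwise norms under a conjugation commuting with \<open>U\<close>\<close>

context
  assumes CU: "\<And>x. C (U x) = U (C x)"
begin

lemma C_Upow: "C ((U ^^ k) x) = (U ^^ k) (C x)"
  by (induction k) (simp_all add: CU)

text \<open>Reflecting the circle and the antilinearity of \<open>C\<close> both replace c by
  \<open>cnj c\<close> in the quadratic test functions, so the two effects cancel.\<close>

lemma spec_measure_C: "conj_measure (spec_measure (C x)) = spec_measure x"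
proof (rule circle_measure_eqI_quadratic[OF circle_borel_conj_measure[OF circle_borel_spec]
      finite_measure_conj_measure[OF circle_borel_spec finite_spec] circle_borel_spec finite_spec])
  fix c :: complex and k :: nat
  have "(\<integral>\<^sup>+\<xi>. ennreal ((cmod (1 + c * \<xi> ^ k))\<^sup>2) \<partial>conj_measure (spec_measure (C x))) =
      (\<integral>\<^sup>+\<xi>. ennreal ((cmod (1 + c * cnj \<xi> ^ k))\<^sup>2) \<partial>spec_measure (C x))"
    by (rule nn_integral_conj_measure[OF circle_borel_spec])
      (auto intro!: measurable_circle_continuous[OF circle_borel_spec] continuous_intros)
  also have "\<dots> = (\<integral>\<^sup>+\<xi>. ennreal ((cmod (1 + cnj c * \<xi> ^ k))\<^sup>2) \<partial>spec_measure (C x))"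
  proof (rule nn_integral_cong)
    fix \<xi> :: complex
    have "1 + cnj c * \<xi> ^ k = cnj (1 + c * cnj \<xi> ^ k)"
      by simp
    then show "ennreal ((cmod (1 + c * cnj \<xi> ^ k))\<^sup>2) = ennreal ((cmod (1 + cnj c * \<xi> ^ k))\<^sup>2)"
      by (simp only: complex_mod_cnj)
  qed
  also have "\<dots> = ennreal ((cnorm (C x + cnj c *\<^sub>C (U ^^ k) (C x)))\<^sup>2)"
    by (rule spec_quadratic)
  also have "C x + cnj c *\<^sub>C (U ^^ k) (C x) = C (x + c *\<^sub>C (U ^^ k) x)"
    by (simp only: C_add C_scaleC C_Upow)
  also have "ennreal ((cnorm (C (x + c *\<^sub>C (U ^^ k) x)))\<^sup>2) =
      (\<integral>\<^sup>+\<xi>. ennreal ((cmod (1 + c * \<xi> ^ k))\<^sup>2) \<partial>spec_measure x)"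
    by (simp only: C_norm spec_quadratic)
  finally show "(\<integral>\<^sup>+\<xi>. ennreal ((cmod (1 + c * \<xi> ^ k))\<^sup>2) \<partial>conj_measure (spec_measure (C x))) =
      (\<integral>\<^sup>+\<xi>. ennreal ((cmod (1 + c * \<xi> ^ k))\<^sup>2) \<partial>spec_measure x)" .
qed

text \<open>Evaluating the spectral measures on \<open>A \<inter> B\<close>, with \<open>A\<close> a
  support of \<open>\<mu> n\<close>, removes all other summands. For \<open>C x\<close> the set
  appears reflected, and \<open>AE_cnj\<close> shows that the reflected support still separates the
  measures.\<close>

lemma component_integral:
  assumes B: "B \<in> sets (\<mu> n)"
  shows "(\<integral>\<^sup>+\<xi>. ennreal ((cnorm (I (C x) n \<xi>))\<^sup>2) * indicator B (cnj \<xi>) \<partial>\<mu> n) =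
    (\<integral>\<^sup>+\<xi>. ennreal ((cnorm (I x n \<xi>))\<^sup>2) * indicator B \<xi> \<partial>\<mu> n)"
proof -
  obtain A where A: "A \<in> sets (\<mu> n)" "AE \<xi> in \<mu> n. \<xi> \<in> A" "\<And>m. m \<noteq> n \<Longrightarrow> AE \<xi> in \<mu> m. \<xi> \<notin> A"
    using ex_support[of n] by blast
  have AB: "A \<inter> B \<in> sets (restrict_space borel (sphere 0 1))"
    using A(1) B by (simp only: sets_mu sets.Int)
  have single: "(\<Sum>m. f m) = f n" if "\<And>m. m \<noteq> n \<Longrightarrow> f m = 0" for f :: "nat \<Rightarrow> ennreal"
    using suminf_finite[of "{n}" f] that by simp
  have "(\<integral>\<^sup>+\<xi>. indicator (A \<inter> B) \<xi> \<partial>spec_measure x) =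
      (\<Sum>m. \<integral>\<^sup>+\<xi>. ennreal ((cnorm (I x m \<xi>))\<^sup>2) * indicator (A \<inter> B) \<xi> \<partial>\<mu> m)"
    by (rule nn_integral_spec) (use AB in simp)
  also have "\<dots> = (\<integral>\<^sup>+\<xi>. ennreal ((cnorm (I x n \<xi>))\<^sup>2) * indicator (A \<inter> B) \<xi> \<partial>\<mu> n)"
  proof (rule single)
    fix m assume "m \<noteq> n"
    have "(\<integral>\<^sup>+\<xi>. ennreal ((cnorm (I x m \<xi>))\<^sup>2) * indicator (A \<inter> B) \<xi> \<partial>\<mu> m) = (\<integral>\<^sup>+\<xi>. 0 \<partial>\<mu> m)"
      by (rule nn_integral_cong_AE) (use A(3)[OF \<open>m \<noteq> n\<close>] in \<open>eventually_elim, simp\<close>)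
    then show "(\<integral>\<^sup>+\<xi>. ennreal ((cnorm (I x m \<xi>))\<^sup>2) * indicator (A \<inter> B) \<xi> \<partial>\<mu> m) = 0"
      by (simp only: nn_integral_const mult_zero_left)
  qed
  also have "\<dots> = (\<integral>\<^sup>+\<xi>. ennreal ((cnorm (I x n \<xi>))\<^sup>2) * indicator B \<xi> \<partial>\<mu> n)"
    by (rule nn_integral_cong_AE) (use A(2) in \<open>eventually_elim, simp add: indicator_def\<close>)
  finally have 1: "(\<integral>\<^sup>+\<xi>. indicator (A \<inter> B) \<xi> \<partial>spec_measure x) =
      (\<integral>\<^sup>+\<xi>. ennreal ((cnorm (I x n \<xi>))\<^sup>2) * indicator B \<xi> \<partial>\<mu> n)" .
  have spec: "A \<inter> B \<in> sets (spec_measure (C x))"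
    using AB by (simp only: sets_circle[OF circle_borel_spec])
  have "(\<integral>\<^sup>+\<xi>. indicator (A \<inter> B) \<xi> \<partial>conj_measure (spec_measure (C x))) =
      (\<integral>\<^sup>+\<xi>. indicator (A \<inter> B) (cnj \<xi>) \<partial>spec_measure (C x))"
    by (rule nn_integral_conj_measure[OF circle_borel_spec]) (use spec in simp)
  also have "\<dots> = (\<Sum>m. \<integral>\<^sup>+\<xi>. ennreal ((cnorm (I (C x) m \<xi>))\<^sup>2) * indicator (A \<inter> B) (cnj \<xi>) \<partial>\<mu> m)"
  proof (rule nn_integral_spec)
    show "(\<lambda>\<xi>. indicator (A \<inter> B) (cnj \<xi>)) \<in> borel_measurable (restrict_space borel (sphere 0 1))"
      using AB by (intro measurable_compose[OF measurable_cnj_circle[OF circle_borel_restrict circle_borel_restrict]]) simp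
  qed
  also have "\<dots> = (\<integral>\<^sup>+\<xi>. ennreal ((cnorm (I (C x) n \<xi>))\<^sup>2) * indicator (A \<inter> B) (cnj \<xi>) \<partial>\<mu> n)"
  proof (rule single)
    fix m assume "m \<noteq> n"
    have "(\<integral>\<^sup>+\<xi>. ennreal ((cnorm (I (C x) m \<xi>))\<^sup>2) * indicator (A \<inter> B) (cnj \<xi>) \<partial>\<mu> m) =
        (\<integral>\<^sup>+\<xi>. 0 \<partial>\<mu> m)"
      by (rule nn_integral_cong_AE)
        (use mu.AE_cnj[OF A(3)[OF \<open>m \<noteq> n\<close>]] in \<open>eventually_elim, simp\<close>)
    then show "(\<integral>\<^sup>+\<xi>. ennreal ((cnorm (I (C x) m \<xi>))\<^sup>2) * indicator (A \<inter> B) (cnj \<xi>) \<partial>\<mu> m) = 0"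
      by (simp only: nn_integral_const mult_zero_left)
  qed
  also have "\<dots> = (\<integral>\<^sup>+\<xi>. ennreal ((cnorm (I (C x) n \<xi>))\<^sup>2) * indicator B (cnj \<xi>) \<partial>\<mu> n)"
    by (rule nn_integral_cong_AE) (use mu.AE_cnj[OF A(2)] in \<open>eventually_elim, simp add: indicator_def\<close>)
  finally show ?thesis
    by (simp only: spec_measure_C 1)
qed

text \<open>Both sides are densities with respect to \<open>\<mu> n\<close> with equal integrals
  over every measurable set, so they agree almost everywhere.\<close>

theorem norm_I_C:
  "AE \<xi> in \<mu> n. (cnorm (I (C x) n \<xi>))\<^sup>2 = enn2real (hdens (\<mu> n) \<xi>) * (cnorm (I x n (cnj \<xi>)))\<^sup>2"
proof -
  let ?f = "\<lambda>\<xi>. ennreal ((cnorm (I x n \<xi>))\<^sup>2)"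
  have f: "?f \<in> borel_measurable (\<mu> n)"
    by measurable
  have fc: "(\<lambda>\<xi>. ?f (cnj \<xi>)) \<in> borel_measurable (\<mu> n)"
    by (rule measurable_compose[OF mu.measurable_cnj f])
  have "AE \<xi> in \<mu> n. ennreal ((cnorm (I (C x) n \<xi>))\<^sup>2) = hdens (\<mu> n) \<xi> * ?f (cnj \<xi>)"
  proof (rule mu.density_unique_finite_measure)
    show "(\<lambda>\<xi>. ennreal ((cnorm (I (C x) n \<xi>))\<^sup>2)) \<in> borel_measurable (\<mu> n)"
      by measurable
    show "(\<lambda>\<xi>. hdens (\<mu> n) \<xi> * ?f (cnj \<xi>)) \<in> borel_measurable (\<mu> n)"
      using fc by measurable
    fix A assume A: "A \<in> sets (\<mu> n)"
    \<comment> \<open>The reflection of \<open>A\<close>: \<open>component_integral\<close> has the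
      reflected argument next to \<open>C x\<close>, whereas the integral over \<open>A\<close> has
      the plain one.\<close>
    define B where "B = cnj -` A \<inter> space (\<mu> n)"
    have B: "B \<in> sets (\<mu> n)"
      unfolding B_def by (rule measurable_sets[OF mu.measurable_cnj A])
    have iB: "indicator B (cnj \<xi>) = (indicator A \<xi> :: ennreal)"
      "indicator B \<xi> = (indicator A (cnj \<xi>) :: ennreal)" if "\<xi> \<in> space (\<mu> n)" for \<xi>
      using that mu.cnj_space[OF that] by (simp_all add: B_def indicator_def)
    have "(\<integral>\<^sup>+\<xi>. ennreal ((cnorm (I (C x) n \<xi>))\<^sup>2) * indicator A \<xi> \<partial>\<mu> n) =
        (\<integral>\<^sup>+\<xi>. ennreal ((cnorm (I (C x) n \<xi>))\<^sup>2) * indicator B (cnj \<xi>) \<partial>\<mu> n)"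
      by (rule nn_integral_cong) (simp only: iB)
    also have "\<dots> = (\<integral>\<^sup>+\<xi>. ?f \<xi> * indicator B \<xi> \<partial>\<mu> n)"
      by (rule component_integral[OF B])
    also have "\<dots> = (\<integral>\<^sup>+\<xi>. ?f (cnj (cnj \<xi>)) * indicator A (cnj \<xi>) \<partial>\<mu> n)"
      by (rule nn_integral_cong) (simp only: iB complex_cnj_cnj)
    also have "\<dots> = (\<integral>\<^sup>+\<xi>. hdens (\<mu> n) \<xi> * (?f (cnj \<xi>) * indicator A \<xi>) \<partial>\<mu> n)"
      by (rule mu.nn_integral_cnj[of "\<lambda>\<xi>. ?f (cnj \<xi>) * indicator A \<xi>"]) (use fc A in measurable)
    finally show "(\<integral>\<^sup>+\<xi>. ennreal ((cnorm (I (C x) n \<xi>))\<^sup>2) * indicator A \<xi> \<partial>\<mu> n) =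
        (\<integral>\<^sup>+\<xi>. hdens (\<mu> n) \<xi> * ?f (cnj \<xi>) * indicator A \<xi> \<partial>\<mu> n)"
      by (simp only: mult.assoc)
  qed simp_all
  with mu.AE_hdens_finite[of n] show ?thesis
  proof eventually_elim
    case (elim \<xi>)
    then have "ennreal ((cnorm (I (C x) n \<xi>))\<^sup>2) =
        ennreal (enn2real (hdens (\<mu> n) \<xi>) * (cnorm (I x n (cnj \<xi>)))\<^sup>2)"
      by (simp add: ennreal_mult)
    then show ?case
      by (simp add: ennreal_inj del: ennreal_mult)
  qed
qed

end

end

section \<open>Conjugations commuting with multiplication by the coordinate\<close>

lemma memL2_mult_xi:
  assumes M: "circle_borel M" and S: "hclosed_subspace S" and f: "memL2 M S f"
  shows "memL2 M S (mult_xi f)"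
  unfolding memL2_def
proof (intro conjI allI ballI)
  have [measurable]: "(\<lambda>\<xi>. \<xi>) \<in> borel_measurable M"
    by (rule measurable_circle_continuous[OF M]) (rule continuous_on_id)
  have [measurable]: "(\<lambda>\<xi>. cinner v (f \<xi>)) \<in> borel_measurable M" for v
    using f by (simp add: memL2_def)
  show "(\<lambda>\<xi>. cinner v (mult_xi f \<xi>)) \<in> borel_measurable M" for v
    unfolding mult_xi_def cinner_scaleC_right by measurable
  show "mult_xi f \<xi> \<in> S" if "\<xi> \<in> space M" for \<xi>
    using f that by (simp add: memL2_def mult_xi_def hclosed_scaleC[OF S])
  have "(\<integral>\<^sup>+\<xi>. ennreal ((cnorm (mult_xi f \<xi>))\<^sup>2) \<partial>M) = (\<integral>\<^sup>+\<xi>. ennreal ((cnorm (f \<xi>))\<^sup>2) \<partial>M)"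
    by (rule nn_integral_cong) (simp add: space_circle[OF M] mult_xi_def cnorm_scaleC)
  then show "(\<integral>\<^sup>+\<xi>. ennreal ((cnorm (mult_xi f \<xi>))\<^sup>2) \<partial>M) < \<infinity>"
    using f by (simp add: memL2_def)
qed

text \<open>Supplies the test functions: \<open>s = 1\<close> gives a constant unit vector, and the
  square root of the density gives the functions that J# sends to constants.\<close>

lemma memL2_scale_const:
  assumes S: "hclosed_subspace S" and u: "u \<in> S" and s: "s \<in> borel_measurable M"
    and fin: "(\<integral>\<^sup>+\<xi>. ennreal ((s \<xi>)\<^sup>2) \<partial>M) < \<infinity>"
  shows "memL2 M S (\<lambda>\<xi>. complex_of_real (s \<xi>) *\<^sub>C u)"
  unfolding memL2_def
proof (intro conjI allI ballI)
  show "(\<lambda>\<xi>. cinner v (complex_of_real (s \<xi>) *\<^sub>C u)) \<in> borel_measurable M" for v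
    unfolding cinner_scaleC_right using s by measurable
  show "complex_of_real (s \<xi>) *\<^sub>C u \<in> S" for \<xi>
    by (rule hclosed_scaleC[OF S u])
  have "(\<integral>\<^sup>+\<xi>. ennreal ((cnorm (complex_of_real (s \<xi>) *\<^sub>C u))\<^sup>2) \<partial>M) =
      (\<integral>\<^sup>+\<xi>. ennreal ((cnorm u)\<^sup>2) * ennreal ((s \<xi>)\<^sup>2) \<partial>M)"
    by (rule nn_integral_cong) (simp add: cnorm_scaleC power_mult_distrib ennreal_mult mult.commute)
  also have "\<dots> = ennreal ((cnorm u)\<^sup>2) * (\<integral>\<^sup>+\<xi>. ennreal ((s \<xi>)\<^sup>2) \<partial>M)"
    using s by (intro nn_integral_cmult) measurable
  also have "\<dots> < \<infinity>"
    using fin by (simp add: ennreal_mult_less_top)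
  finally show "(\<integral>\<^sup>+\<xi>. ennreal ((cnorm (complex_of_real (s \<xi>) *\<^sub>C u))\<^sup>2) \<partial>M) < \<infinity>" .
qed

section \<open>Componentwise conjugations or operator fields force commutation\<close>

context spectral_rep
begin

lemma ex_preimage:
  assumes f: "memL2 (\<mu> n) (E n) f"
  shows "\<exists>x. AE \<xi> in \<mu> n. I x n \<xi> = f \<xi>"
proof -
  define F where "F m \<xi> = (if m = n then f \<xi> else 0)" for m \<xi>
  have F: "memL2 (\<mu> m) (E m) (F m)" for m
  proof (cases "m = n")
    case True
    then have "F m = f"
      by (simp add: F_def fun_eq_iff)
    then show ?thesis
      using f True by simp
  next
    case False
    then show ?thesis
      by (simp add: F_def memL2_def hclosed_zero[OF E_sub])
  qed
  have "(\<Sum>m. \<integral>\<^sup>+\<xi>. ennreal ((cnorm (F m \<xi>))\<^sup>2) \<partial>\<mu> m) =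
      (\<Sum>m\<in>{n}. \<integral>\<^sup>+\<xi>. ennreal ((cnorm (F m \<xi>))\<^sup>2) \<partial>\<mu> m)"
    by (rule suminf_finite) (simp_all add: F_def)
  also have "\<dots> < \<infinity>"
    using F[of n] by (simp add: memL2_def)
  finally have "memL2H \<mu> E F"
    using F by (simp add: memL2H_def)
  then obtain x where "aeqH \<mu> (I x) F"
    using I_iso unfolding isometric_iso_def by blast
  then have "AE \<xi> in \<mu> n. I x n \<xi> = F n \<xi>"
    unfolding aeqH_def by blast
  then show ?thesis
    by (auto simp: F_def)
qed

lemma CUC_iff: "(\<forall>x. C (U (C x)) = U x) \<longleftrightarrow> (\<forall>x. C (U x) = U (C x))"
  by (metis C_C)

text \<open>\<open>Cs n\<close> acts on representatives, so replacing its argument by an almost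
  everywhere equal one needs the congruence clause of \<open>conjugation_L2\<close> and membership
  of both arguments in L^2.\<close>

lemma commute_if_decomposes:
  assumes Cs: "\<And>n. conjugation_L2 (\<mu> n) (E n) (Cs n)"
    and comm: "\<And>n f. memL2 (\<mu> n) (E n) f \<Longrightarrow> AE \<xi> in \<mu> n. Cs n (mult_xi (Cs n f)) \<xi> = mult_xi f \<xi>"
    and C: "\<And>x. aeqH \<mu> (I (C x)) (\<lambda>n. Cs n (I x n))"
  shows "C (U (C x)) = U x"
proof (rule I_inj)
  fix n
  have rep: "AE \<xi> in \<mu> n. I (C y) n \<xi> = Cs n (I y n) \<xi>" for y
    using C by (simp add: aeqH_def)
  have cong: "AE \<xi> in \<mu> n. Cs n f \<xi> = Cs n g \<xi>"
    if "memL2 (\<mu> n) (E n) f" "memL2 (\<mu> n) (E n) g" "AE \<xi> in \<mu> n. f \<xi> = g \<xi>" for f g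
    using Cs[of n] that unfolding conjugation_L2_def by blast
  have mem: "memL2 (\<mu> n) (E n) (Cs n (I x n))"
    using Cs[of n] memL2_I[of n x] unfolding conjugation_L2_def by blast
  have "AE \<xi> in \<mu> n. I (U (C x)) n \<xi> = mult_xi (Cs n (I x n)) \<xi>"
    using I_mult[of "C x" n] rep[of x] by eventually_elim (simp add: mult_xi_def)
  then have "AE \<xi> in \<mu> n. Cs n (I (U (C x)) n) \<xi> = Cs n (mult_xi (Cs n (I x n))) \<xi>"
    by (rule cong[OF memL2_I memL2_mult_xi[OF mu_borel E_sub mem]])
  with rep[of "U (C x)"] comm[OF memL2_I[of n x]] I_mult[of x n]
  show "AE \<xi> in \<mu> n. I (C (U (C x))) n \<xi> = I (U x) n \<xi>"
    by eventually_elim (simp add: mult_xi_def)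
qed

text \<open>The reflected argument in \<open>Jsharp\<close> produces the factor
  \<open>cnj \<xi>\<close>, and the antilinear \<open>J n\<close> turns it back into
  \<open>\<xi>\<close>, which passes through the linear \<open>W n \<xi>\<close>.\<close>

lemma commute_if_multiplication:
  assumes J: "\<And>n. conjugation_on (E n) (J n)"
    and W: "\<And>n. AE \<xi> in \<mu> n. hunitary_on (E n) (W n \<xi>)"
    and C: "\<And>x. aeqH \<mu> (I (C x)) (\<lambda>n \<xi>. W n \<xi> (Jsharp (\<mu> n) (J n) (I x n) \<xi>))"
  shows "C (U x) = U (C x)"
proof (rule I_inj)
  fix n
  have rep: "AE \<xi> in \<mu> n. I (C y) n \<xi> = W n \<xi> (Jsharp (\<mu> n) (J n) (I y n) \<xi>)" for y
    using C by (simp add: aeqH_def)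
  from rep[of "U x"] rep[of x] I_mult[of "C x" n] mu.AE_cnj[OF I_mult[of x n]] W[of n] AE_space
  show "AE \<xi> in \<mu> n. I (C (U x)) n \<xi> = I (U (C x)) n \<xi>"
  proof eventually_elim
    case (elim \<xi>)
    let ?v = "I x n (cnj \<xi>)" and ?s = "complex_of_real (sqrt (enn2real (hdens (\<mu> n) \<xi>)))"
    have v: "?v \<in> E n"
      by (rule I_in[OF mu.cnj_space[OF elim(6)]])
    have Jv: "J n ?v \<in> E n" "J n (cnj \<xi> *\<^sub>C ?v) = \<xi> *\<^sub>C J n ?v"
      using J[of n] v by (simp_all add: conjugation_on_def)
    have "I (C (U x)) n \<xi> = W n \<xi> (?s *\<^sub>C J n (cnj \<xi> *\<^sub>C ?v))"
      by (simp only: elim(1) Jsharp_def elim(4))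
    also have "\<dots> = W n \<xi> (\<xi> *\<^sub>C ?s *\<^sub>C J n ?v)"
      by (simp only: Jv(2) scaleC_scaleC mult.commute)
    also have "\<dots> = \<xi> *\<^sub>C W n \<xi> (?s *\<^sub>C J n ?v)"
      using elim(5) hclosed_scaleC[OF E_sub Jv(1), of ?s] by (simp add: hunitary_on_def hlinear_on_def)
    also have "\<dots> = I (U (C x)) n \<xi>"
      by (simp only: elim(3) elim(2) Jsharp_def)
    finally show ?case .
  qed
qed

text \<open>\<open>dimidx\<close> never takes the value 0, so a basis of \<open>E n\<close> is
  nonempty.\<close>

lemma ex_unit: "\<exists>u\<in>E n. cnorm u = 1"
proof -
  obtain B where B: "B \<subseteq> E n" "horthonormal B"
    "if dimidx n = \<infinity> then infinite B \<and> countable B else finite B \<and> enat (card B) = dimidx n"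
    using E_dim[of n] unfolding hilbert_dim_def by blast
  have "B \<noteq> {}"
    using B(3) by (auto simp: dimidx_def split: if_splits)
  then obtain u where "u \<in> B"
    by blast
  then have "u \<in> E n" "cinner u u = 1"
    using B by (auto simp: horthonormal_def)
  then show ?thesis
    by (intro bexI[of _ u]) (simp_all add: cnorm_def)
qed

section \<open>Commutation yields the conjugations of (b) and the operators of (c)\<close>

context
  assumes CU: "\<And>x. C (U x) = U (C x)"
begin

text \<open>If the n-th component of a difference vanishes, so does its reflection, and
  \<open>norm_I_C\<close> passes this on to the image under \<open>C\<close>. Hence \<open>C\<close>
  induces a well-defined map on each component.\<close>

lemma I_C_cong:
  assumes "AE \<xi> in \<mu> n. I x n \<xi> = I y n \<xi>"
  shows "AE \<xi> in \<mu> n. I (C x) n \<xi> = I (C y) n \<xi>"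
proof -
  let ?z = "x + (- 1) *\<^sub>C y"
  have "AE \<xi> in \<mu> n. I ?z n \<xi> = 0"
    using assms I_add[of x "(- 1) *\<^sub>C y" n] I_scaleC[of "- 1" y n]
    by eventually_elim (simp add: scaleC_minus_one)
  from norm_I_C[OF CU, of ?z n] mu.AE_cnj[OF this]
  have "AE \<xi> in \<mu> n. I (C ?z) n \<xi> = 0"
    by eventually_elim simp
  moreover have "C ?z = C x + (- 1) *\<^sub>C C y"
    by (simp only: C_add C_scaleC) simp
  ultimately have "AE \<xi> in \<mu> n. I (C x + (- 1) *\<^sub>C C y) n \<xi> = 0"
    by simp
  with I_add[of "C x" "(- 1) *\<^sub>C C y" n] I_scaleC[of "- 1" "C y" n] show ?thesis
    by eventually_elim (simp add: scaleC_minus_one)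
qed

lemma decomposes_if_commute:
  "\<exists>Cs. (\<forall>n. conjugation_L2 (\<mu> n) (E n) (Cs n)
        \<and> (\<forall>f. memL2 (\<mu> n) (E n) f \<longrightarrow> (AE \<xi> in \<mu> n. Cs n (mult_xi (Cs n f)) \<xi> = mult_xi f \<xi>)))
      \<and> (\<forall>x. aeqH \<mu> (I (C x)) (\<lambda>n. Cs n (I x n)))"
proof -
  \<comment> \<open>An arbitrary lift of \<open>f\<close> to the Hilbert space. Its other components
    are uncontrolled, which is harmless: by \<open>I_C_cong\<close> only the n-th one affects the
    result.\<close>
  define pre where "pre n f = (SOME x. AE \<xi> in \<mu> n. I x n \<xi> = f \<xi>)" for n f
  define Cs where "Cs n f = I (C (pre n f)) n" for n f
  have pre: "AE \<xi> in \<mu> n. I (pre n f) n \<xi> = f \<xi>" if "memL2 (\<mu> n) (E n) f" for n f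
    unfolding pre_def using ex_preimage[OF that] by (rule someI_ex)
  have Cs_eq: "AE \<xi> in \<mu> n. Cs n f \<xi> = I (C x) n \<xi>" if x: "AE \<xi> in \<mu> n. I x n \<xi> = f \<xi>" for n f x
  proof -
    have "AE \<xi> in \<mu> n. I (pre n f) n \<xi> = f \<xi>"
      unfolding pre_def by (rule someI[of "\<lambda>x. AE \<xi> in \<mu> n. I x n \<xi> = f \<xi>", OF x])
    with x have "AE \<xi> in \<mu> n. I (pre n f) n \<xi> = I x n \<xi>"
      by eventually_elim simp
    then show ?thesis
      unfolding Cs_def by (rule I_C_cong)
  qed
  have Cs_I: "AE \<xi> in \<mu> n. Cs n (I x n) \<xi> = I (C x) n \<xi>" for n x
    by (rule Cs_eq) simp
  have "conjugation_L2 (\<mu> n) (E n) (Cs n)" for n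
    unfolding conjugation_L2_def
  proof (intro conjI allI impI; (elim conjE)?)
    fix f g c
    assume f: "memL2 (\<mu> n) (E n) f"
    show "memL2 (\<mu> n) (E n) (Cs n f)"
      unfolding Cs_def by (rule memL2_I)
    show "AE \<xi> in \<mu> n. Cs n (\<lambda>\<eta>. c *\<^sub>C f \<eta>) \<xi> = cnj c *\<^sub>C Cs n f \<xi>"
    proof -
      have "AE \<xi> in \<mu> n. I (c *\<^sub>C pre n f) n \<xi> = c *\<^sub>C f \<xi>"
        using I_scaleC[of c "pre n f" n] pre[OF f] by eventually_elim simp
      from Cs_eq[OF this] I_scaleC[of "cnj c" "C (pre n f)" n] show ?thesis
        by eventually_elim (simp add: Cs_def C_scaleC)
    qed
    show "(\<integral>\<^sup>+\<xi>. ennreal ((cnorm (Cs n f \<xi>))\<^sup>2) \<partial>\<mu> n) = (\<integral>\<^sup>+\<xi>. ennreal ((cnorm (f \<xi>))\<^sup>2) \<partial>\<mu> n)"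
    proof -
      \<comment> \<open>Taking the whole circle as test set turns \<open>component_integral\<close>
        into preservation of the L^2 norm on one component.\<close>
      let ?B = "space (\<mu> n)"
      have "(\<integral>\<^sup>+\<xi>. ennreal ((cnorm (Cs n f \<xi>))\<^sup>2) \<partial>\<mu> n) =
          (\<integral>\<^sup>+\<xi>. ennreal ((cnorm (I (C (pre n f)) n \<xi>))\<^sup>2) * indicator ?B (cnj \<xi>) \<partial>\<mu> n)"
        unfolding Cs_def by (rule nn_integral_cong) (simp add: mu.cnj_space)
      also have "\<dots> = (\<integral>\<^sup>+\<xi>. ennreal ((cnorm (I (pre n f) n \<xi>))\<^sup>2) * indicator ?B \<xi> \<partial>\<mu> n)"
        by (rule component_integral[OF CU sets.top])
      also have "\<dots> = (\<integral>\<^sup>+\<xi>. ennreal ((cnorm (f \<xi>))\<^sup>2) \<partial>\<mu> n)"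
        by (rule nn_integral_cong_AE) (use pre[OF f] AE_space in \<open>eventually_elim, simp\<close>)
      finally show ?thesis .
    qed
    show "AE \<xi> in \<mu> n. Cs n (Cs n f) \<xi> = f \<xi>"
    proof -
      have "AE \<xi> in \<mu> n. Cs n (Cs n f) \<xi> = I (C (C (pre n f))) n \<xi>"
        by (rule Cs_eq) (simp add: Cs_def)
      with pre[OF f] show ?thesis
        by eventually_elim (simp add: C_C)
    qed
    assume g: "memL2 (\<mu> n) (E n) g"
    show "AE \<xi> in \<mu> n. Cs n (\<lambda>\<eta>. f \<eta> + g \<eta>) \<xi> = Cs n f \<xi> + Cs n g \<xi>"
    proof -
      have "AE \<xi> in \<mu> n. I (pre n f + pre n g) n \<xi> = f \<xi> + g \<xi>"
        using I_add[of "pre n f" "pre n g" n] pre[OF f] pre[OF g] by eventually_elim simp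
      from Cs_eq[OF this] I_add[of "C (pre n f)" "C (pre n g)" n] show ?thesis
        by eventually_elim (simp add: Cs_def C_add)
    qed
    assume "AE \<xi> in \<mu> n. f \<xi> = g \<xi>"
    with pre[OF g] have "AE \<xi> in \<mu> n. I (pre n g) n \<xi> = f \<xi>"
      by eventually_elim simp
    from Cs_eq[OF this] show "AE \<xi> in \<mu> n. Cs n f \<xi> = Cs n g \<xi>"
      unfolding Cs_def[of n g] .
  qed
  moreover have "AE \<xi> in \<mu> n. Cs n (mult_xi (Cs n f)) \<xi> = mult_xi f \<xi>" if f: "memL2 (\<mu> n) (E n) f" for n f
  proof -
    have "AE \<xi> in \<mu> n. I (U (C (pre n f))) n \<xi> = mult_xi (Cs n f) \<xi>"
      using I_mult by (simp add: Cs_def mult_xi_def)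
    from Cs_eq[OF this] I_mult[of "pre n f" n] pre[OF f] show ?thesis
      by eventually_elim (simp add: CU C_C mult_xi_def)
  qed
  moreover have "aeqH \<mu> (I (C x)) (\<lambda>n. Cs n (I x n))" for x
    unfolding aeqH_def
  proof
    fix n
    from Cs_I[of n x] show "AE \<xi> in \<mu> n. I (C x) n \<xi> = Cs n (I x n) \<xi>"
      by eventually_elim simp
  qed
  ultimately show ?thesis
    by blast
qed

text \<open>\<open>norm_I_C\<close> for \<open>x\<close>, \<open>y\<close>, \<open>x + y\<close> and
  \<open>x + (- \<i>) *\<^sub>C y\<close>, polarised pointwise; antilinearity of \<open>C\<close>
  swaps the arguments on the right.\<close>

lemma cinner_I_C:
  "AE \<xi> in \<mu> n. cinner (I (C x) n \<xi>) (I (C y) n \<xi>) =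
    complex_of_real (enn2real (hdens (\<mu> n) \<xi>)) * cinner (I y n (cnj \<xi>)) (I x n (cnj \<xi>))"
proof -
  note norm = norm_I_C[OF CU]
  have C_i: "C (x + (- \<i>) *\<^sub>C y) = C x + \<i> *\<^sub>C C y"
    by (simp only: C_add C_scaleC) simp
  from norm[of x n] norm[of y n] norm[of "x + y" n] norm[of "x + (- \<i>) *\<^sub>C y" n]
    I_add[of "C x" "C y" n] I_add[of "C x" "\<i> *\<^sub>C C y" n] I_scaleC[of "\<i>" "C y" n]
    mu.AE_cnj[OF I_add[of x y n]] mu.AE_cnj[OF I_add[of x "(- \<i>) *\<^sub>C y" n]]
    mu.AE_cnj[OF I_scaleC[of "- \<i>" y n]]
  show ?thesis
  proof eventually_elim
    case (elim \<xi>)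
    show ?case
    proof (rule cinner_eqI_norm_cnj)
      show "(cnorm (I (C x) n \<xi> + I (C y) n \<xi>))\<^sup>2 =
          enn2real (hdens (\<mu> n) \<xi>) * (cnorm (I x n (cnj \<xi>) + I y n (cnj \<xi>)))\<^sup>2"
        unfolding elim(5)[symmetric] elim(8)[symmetric] C_add[symmetric] by (rule elim(3))
      show "(cnorm (I (C x) n \<xi> + \<i> *\<^sub>C I (C y) n \<xi>))\<^sup>2 =
          enn2real (hdens (\<mu> n) \<xi>) * (cnorm (I x n (cnj \<xi>) + (- \<i>) *\<^sub>C I y n (cnj \<xi>)))\<^sup>2"
        unfolding elim(7)[symmetric] elim(6)[symmetric] elim(10)[symmetric] elim(9)[symmetric]
          C_i[symmetric] by (rule elim(4))
    qed (rule elim(1) elim(2))+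
  qed
qed

text \<open>For \<open>x\<close> with constant unit n-th component, \<open>norm_I_C\<close> applied
  to \<open>C x\<close> and then, reflected, to \<open>x\<close> gives the product of the two
  densities as the squared norm of the component of \<open>C (C x) = x\<close>, which is 1.\<close>

lemma hdens_mult_cnj: "AE \<xi> in \<mu> n. enn2real (hdens (\<mu> n) \<xi>) * enn2real (hdens (\<mu> n) (cnj \<xi>)) = 1"
proof -
  obtain u where u: "u \<in> E n" "cnorm u = 1"
    using ex_unit by blast
  have "memL2 (\<mu> n) (E n) (\<lambda>\<xi>. complex_of_real 1 *\<^sub>C u)"
    by (rule memL2_scale_const[OF E_sub u(1)]) (simp_all add: mu.emeasure_finite less_top[symmetric])
  then obtain x where x: "AE \<xi> in \<mu> n. I x n \<xi> = u"
    using ex_preimage by (fastforce simp: scaleC_one)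
  from norm_I_C[OF CU, of "C x" n] mu.AE_cnj[OF norm_I_C[OF CU, of x n]] x
  show ?thesis
    by eventually_elim (simp add: C_C u(2))
qed

text \<open>If \<open>C\<close> equals \<open>W\<close> after J#, a vector whose J# image is the
  constant \<open>b k\<close> reveals \<open>W \<xi> (b k)\<close>. So \<open>W\<close> is defined
  by these images, and the remaining work is to show that it represents \<open>C\<close> everywhere
  and is unitary.\<close>

lemma multiplication_if_commute:
  assumes J: "conjugation_on (E n) J"
  shows "\<exists>W. Linf_op (\<mu> n) (E n) W
    \<and> (AE \<xi> in \<mu> n. hunitary_on (E n) (W \<xi>))
    \<and> (AE \<xi> in \<mu> n. \<forall>v\<in>E n. \<forall>w\<in>E n. cinner (J (W \<xi> (J w))) v = cinner w (W (cnj \<xi>) v))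
    \<and> (\<forall>x. AE \<xi> in \<mu> n. I (C x) n \<xi> = W \<xi> (Jsharp (\<mu> n) J (I x n) \<xi>))"
proof -
  obtain b where b: "onb_seq (E n) b"
    using ex_onb by blast
  have bE: "b k \<in> E n" for k
    using b by (auto simp: onb_seq_def)
  have J_in: "J v \<in> E n" and J_J: "J (J v) = v" and J_norm: "cnorm (J v) = cnorm v"
    and J_scale: "J (c *\<^sub>C v) = cnj c *\<^sub>C J v" if "v \<in> E n" for v c
    using J that by (simp_all add: conjugation_on_def)
  have J_add: "J (v + w) = J v + J w" if "v \<in> E n" "w \<in> E n" for v w
    using J that by (simp add: conjugation_on_def)
  note J_inner = conjugation_on_cinner[OF E_sub J]
  define h where "h \<xi> = enn2real (hdens (\<mu> n) \<xi>)" for \<xi>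
  define s where "s \<xi> = sqrt (h \<xi>)" for \<xi>
  have h_ge: "h \<xi> \<ge> 0" for \<xi>
    by (simp add: h_def)
  have h_s: "h \<xi> = s \<xi> * s \<xi>" for \<xi>
    using h_ge[of \<xi>] by (simp add: s_def)
  have s_s: "s \<xi> * s (cnj \<xi>) = 1" if "h \<xi> * h (cnj \<xi>) = 1" for \<xi>
    using that unfolding s_def real_sqrt_mult[symmetric] by simp
  have [measurable]: "h \<in> borel_measurable (\<mu> n)"
    unfolding h_def[abs_def] by measurable
  then have s_meas: "s \<in> borel_measurable (\<mu> n)"
    unfolding s_def[abs_def] by measurable
  have Jsharp_eq: "Jsharp (\<mu> n) J f \<xi> = complex_of_real (s \<xi>) *\<^sub>C J (f (cnj \<xi>))" for f \<xi>
    by (simp add: Jsharp_def s_def h_def)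
  have s_int: "(\<integral>\<^sup>+\<xi>. ennreal ((s \<xi>)\<^sup>2) \<partial>\<mu> n) < \<infinity>"
  proof -
    have "(\<integral>\<^sup>+\<xi>. ennreal ((s \<xi>)\<^sup>2) \<partial>\<mu> n) = (\<integral>\<^sup>+\<xi>. hdens (\<mu> n) \<xi> \<partial>\<mu> n)"
      by (rule nn_integral_cong_AE)
        (use mu.AE_hdens_finite[of n] in \<open>eventually_elim, simp add: power2_eq_square h_s[symmetric] h_def\<close>)
    then show ?thesis
      using mu.nn_integral_hdens by simp
  qed
  \<comment> \<open>J# sends this function to \<open>s \<xi> * s (cnj \<xi>)\<close> times
    \<open>b k\<close>, that is, to the constant \<open>b k\<close> almost everywhere; its square
    integrability is that of \<open>s\<close>.\<close>
  have "\<exists>x. AE \<xi> in \<mu> n. I x n \<xi> = complex_of_real (s \<xi>) *\<^sub>C J (b k)" for k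
    by (rule ex_preimage[OF memL2_scale_const[OF E_sub J_in[OF bE] s_meas s_int]])
  then obtain X where X: "AE \<xi> in \<mu> n. I (X k) n \<xi> = complex_of_real (s \<xi>) *\<^sub>C J (b k)" for k
    by metis
  then have AE_X: "AE \<xi> in \<mu> n. \<forall>k. I (X k) n \<xi> = complex_of_real (s \<xi>) *\<^sub>C J (b k)"
    by (simp add: AE_all_countable)
  have AE_h: "AE \<xi> in \<mu> n. h \<xi> * h (cnj \<xi>) = 1"
    using hdens_mult_cnj by (simp add: h_def)
  define d0 where "d0 k \<xi> = I (C (X k)) n \<xi>" for k \<xi>
  have "AE \<xi> in \<mu> n. \<forall>j k. cinner (d0 j \<xi>) (d0 k \<xi>) =
      complex_of_real (h \<xi>) * cinner (I (X k) n (cnj \<xi>)) (I (X j) n (cnj \<xi>))"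
    using cinner_I_C by (simp add: AE_all_countable d0_def h_def)
  with AE_h mu.AE_cnj[OF AE_X]
  have "AE \<xi> in \<mu> n. \<forall>j k. cinner (d0 j \<xi>) (d0 k \<xi>) = cinner (b j) (b k)"
  proof eventually_elim
    case (elim \<xi>)
    have "complex_of_real (h \<xi>) * (complex_of_real (s (cnj \<xi>)) * complex_of_real (s (cnj \<xi>))) = 1"
      using elim(1) h_s[of "cnj \<xi>"] by (simp only: of_real_mult[symmetric]) simp
    then show ?case
      using elim(2,3) J_inner[OF bE bE]
      by (simp add: cinner_scaleC_left cinner_scaleC_right mult.assoc[symmetric])
  qed
  \<comment> \<open>One null set serves all pairs \<open>j\<close>, \<open>k\<close>, because the
    basis is countable.\<close>
  then obtain N where N: "{\<xi> \<in> space (\<mu> n). \<not> (\<forall>j k. cinner (d0 j \<xi>) (d0 k \<xi>) = cinner (b j) (b k))} \<subseteq> N"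
    "N \<in> null_sets (\<mu> n)"
    by (auto elim: AE_E simp: null_sets_def)
  define G where "G = space (\<mu> n) - N"
  have G: "G \<in> sets (\<mu> n)"
    using N(2) by (auto simp: G_def)
  have AE_G: "AE \<xi> in \<mu> n. \<xi> \<in> G"
    using AE_not_in[OF N(2)] AE_space by eventually_elim (simp add: G_def)
  \<comment> \<open>Falling back to \<open>b\<close> on the null set makes the Gram identity hold at
    every \<open>\<xi>\<close>, so \<open>W\<close> is an isometry everywhere; measurability of
    \<open>G\<close> keeps the patched family weakly measurable.\<close>
  define d where "d \<xi> k = (if \<xi> \<in> G then d0 k \<xi> else b k)" for \<xi> k
  have dE: "d \<xi> k \<in> E n" for \<xi> k
    using bE I_in[of \<xi> n "C (X k)"] by (simp add: d_def d0_def G_def)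
  have iso: "cinner (d \<xi> j) (d \<xi> k) = cinner (b j) (b k)" for \<xi> j k
    using N(1) by (auto simp: d_def G_def)
  have od: "orthoseq (d \<xi>)" for \<xi>
    using b iso by (auto simp: onb_seq_def intro: orthoseq_cong)
  define W0 where "W0 \<xi> w = hsum (\<lambda>k. cinner (b k) w) (d \<xi>)" for \<xi> w
  have W0: "hlinear_on (E n) (W0 \<xi>)" "\<forall>w\<in>E n. cnorm (W0 \<xi> w) = cnorm w" "\<And>k. W0 \<xi> (b k) = d \<xi> k" for \<xi>
    unfolding W0_def[abs_def] using onb_map_isometry[OF E_sub b dE iso] by blast+
  \<comment> \<open>\<open>Linf_op\<close> asks for weak measurability at every vector of the type,
    also outside \<open>E n\<close>, where Fourier coefficients need not determine a convergent
    choice-free value; 0 is safe there.\<close>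
  define W where "W \<xi> w = (if w \<in> E n then W0 \<xi> w else 0)" for \<xi> w
  have W_eq: "W \<xi> w = W0 \<xi> w" if "w \<in> E n" for \<xi> w
    using that by (simp add: W_def)
  have W_lin: "hlinear_on (E n) (W \<xi>)" for \<xi>
    using W0(1)[of \<xi>] hclosed_add[OF E_sub] hclosed_scaleC[OF E_sub]
    by (simp add: hlinear_on_def W_eq)
  have W_norm: "\<forall>w\<in>E n. cnorm (W \<xi> w) = cnorm w" for \<xi>
    using W0(2) by (simp add: W_eq)
  have W_b: "W \<xi> (b k) = d \<xi> k" for \<xi> k
    using W0(3) by (simp add: W_eq bE)
  have W_in: "W \<xi> w \<in> E n" and W_scale: "W \<xi> (c *\<^sub>C w) = c *\<^sub>C W \<xi> w" if "w \<in> E n" for \<xi> w c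
    using W_lin[of \<xi>] that by (simp_all add: hlinear_on_def)
  have W_add: "W \<xi> (v + w) = W \<xi> v + W \<xi> w" if "v \<in> E n" "w \<in> E n" for \<xi> v w
    using W_lin[of \<xi>] that by (simp add: hlinear_on_def)
  note W_inner = hlinear_isometry_cinner[OF E_sub W_lin W_norm]
  have W_meas: "(\<lambda>\<xi>. cinner v (W \<xi> w)) \<in> borel_measurable (\<mu> n)" for v w
  proof (cases "w \<in> E n")
    case True
    have [measurable]: "(\<lambda>\<xi>. cinner v (d \<xi> k)) \<in> borel_measurable (\<mu> n)" for k
    proof -
      have "(\<lambda>\<xi>. cinner v (d0 k \<xi>)) \<in> borel_measurable (\<mu> n)"
        using memL2_I by (simp add: d0_def memL2_def)
      then have "(\<lambda>\<xi>. if \<xi> \<in> G then cinner v (d0 k \<xi>) else cinner v (b k)) \<in> borel_measurable (\<mu> n)"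
        using G by measurable
      then show ?thesis
        by (simp add: d_def if_distrib)
    qed
    show ?thesis
    proof (rule borel_measurable_LIMSEQ_metric)
      show "(\<lambda>\<xi>. \<Sum>k<i. cinner (b k) w * cinner v (d \<xi> k)) \<in> borel_measurable (\<mu> n)" for i
        by measurable
      show "(\<lambda>i. \<Sum>k<i. cinner (b k) w * cinner v (d \<xi> k)) \<longlonglongrightarrow> cinner v (W \<xi> w)" for \<xi>
        using cinner_hsum[OF od summable_coeff[OF b True]] by (simp add: sums_def W_eq[OF True] W0_def)
    qed
  qed (simp add: W_def)
  \<comment> \<open>At this stage \<open>d \<xi>\<close> is not known to be complete, so equal
    coefficients alone would not identify \<open>I (C x) n \<xi>\<close>. The equal norm from
    \<open>norm_I_C\<close> closes the gap through \<open>hsum_eqI\<close>.\<close>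
  have rep: "AE \<xi> in \<mu> n. I (C x) n \<xi> = W \<xi> (Jsharp (\<mu> n) J (I x n) \<xi>)" for x
  proof -
    have "AE \<xi> in \<mu> n. \<forall>k. cinner (d0 k \<xi>) (I (C x) n \<xi>) =
        complex_of_real (h \<xi>) * cinner (I x n (cnj \<xi>)) (I (X k) n (cnj \<xi>))"
      using cinner_I_C by (simp add: AE_all_countable d0_def h_def)
    with mu.AE_cnj[OF AE_X] AE_G AE_h norm_I_C[OF CU, of x n] AE_space show ?thesis
    proof eventually_elim
      case (elim \<xi>)
      let ?v = "I x n (cnj \<xi>)" and ?s = "complex_of_real (s \<xi>)"
      have v: "?v \<in> E n"
        by (rule I_in[OF mu.cnj_space[OF elim(5)]])
      note Jv = J_in[OF v]
      have y: "?s *\<^sub>C J ?v \<in> E n"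
        by (rule hclosed_scaleC[OF E_sub Jv])
      have "h \<xi> * s (cnj \<xi>) = s \<xi>"
        using s_s[OF elim(3)] by (simp add: h_s mult.assoc)
      then have hs: "complex_of_real (h \<xi>) * complex_of_real (s (cnj \<xi>)) = ?s"
        by (simp only: of_real_mult[symmetric])
      have "cinner (d \<xi> k) (I (C x) n \<xi>) = cinner (b k) (?s *\<^sub>C J ?v)" for k
      proof -
        have "cinner (d \<xi> k) (I (C x) n \<xi>) =
            complex_of_real (h \<xi>) * (complex_of_real (s (cnj \<xi>)) * cinner ?v (J (b k)))"
          using elim(1,2,6) by (simp add: d_def cinner_scaleC_right)
        also have "\<dots> = ?s * cinner ?v (J (b k))"
          by (simp only: mult.assoc[symmetric] hs)
        also have "cinner ?v (J (b k)) = cinner (b k) (J ?v)"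
          using J_inner[OF J_in[OF bE[of k]] v] by (simp add: J_J bE)
        finally show ?thesis
          by (simp only: cinner_scaleC_right)
      qed
      moreover have "(cnorm (I (C x) n \<xi>))\<^sup>2 = (cnorm (?s *\<^sub>C J ?v))\<^sup>2"
        using elim(4) by (simp add: cnorm_scaleC J_norm[OF v] power_mult_distrib power2_eq_square[of "s \<xi>"]
            h_s[symmetric] h_def[symmetric])
      ultimately have "hsum (\<lambda>k. cinner (b k) (?s *\<^sub>C J ?v)) (d \<xi>) = I (C x) n \<xi>"
        by (rule hsum_eqI[OF E_sub b dE iso y])
      then show ?case
        by (simp only: Jsharp_eq W_eq[OF y] W0_def)
    qed
  qed
  have W_J_W: "AE \<xi> in \<mu> n. \<forall>w\<in>E n. W \<xi> (J (W (cnj \<xi>) w)) = J w"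
  proof -
    \<comment> \<open>The representation applied to \<open>C (X k)\<close>: as
      \<open>C C = 1\<close>, the left side is again the known function
      \<open>I (X k) n\<close>.\<close>
    have "AE \<xi> in \<mu> n. \<forall>k. I (X k) n \<xi> = W \<xi> (Jsharp (\<mu> n) J (d0 k) \<xi>)"
      using rep[of "C (X _)"] by (simp add: AE_all_countable C_C d0_def[abs_def])
    with AE_X mu.AE_cnj[OF AE_G] AE_h show ?thesis
    proof eventually_elim
      case (elim \<xi>)
      let ?s = "complex_of_real (s \<xi>)"
      have s: "?s \<noteq> 0"
        using s_s[OF elim(3)] by auto
      have eq_b: "W \<xi> (J (W (cnj \<xi>) (b k))) = J (b k)" for k
      proof -
        have "?s *\<^sub>C J (b k) = W \<xi> (?s *\<^sub>C J (d (cnj \<xi>) k))"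
          using elim(1,2,4) by (simp add: Jsharp_eq d_def)
        also have "\<dots> = ?s *\<^sub>C W \<xi> (J (W (cnj \<xi>) (b k)))"
          by (simp only: W_b W_scale[OF J_in[OF dE]])
        finally have "inverse ?s *\<^sub>C ?s *\<^sub>C J (b k) = inverse ?s *\<^sub>C ?s *\<^sub>C W \<xi> (J (W (cnj \<xi>) (b k)))"
          by (rule arg_cong)
        then show ?thesis
          using s by (simp add: scaleC_scaleC scaleC_one)
      qed
      have "W \<xi> (J (W (cnj \<xi>) w)) = J w" if "w \<in> E n" for w
      \<comment> \<open>Linear, antilinear, linear compose to an antilinear isometry, which agrees
        with \<open>J\<close> on the basis; thus a single null set covers all
        \<open>w\<close>.\<close>
      proof (rule antilinear_isometry_eqI[OF E_sub b, where A = "\<lambda>w. W \<xi> (J (W (cnj \<xi>) w))", rotated -1])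
        show "w \<in> E n"
          by (rule that)
      qed (simp_all add: W_add W_scale W_in J_add J_scale J_in J_norm W_norm eq_b)
      then show ?case
        by blast
    qed
  qed
  have "Linf_op (\<mu> n) (E n) W"
    unfolding Linf_op_def hbounded_on_def
    using W_meas W_lin W_norm by (auto intro!: exI[of _ 1])
  moreover have "AE \<xi> in \<mu> n. hunitary_on (E n) (W \<xi>)"
    using W_J_W
  proof eventually_elim
    case (elim \<xi>)
    have "u \<in> W \<xi> ` E n" if "u \<in> E n" for u
    proof (rule image_eqI)
      \<comment> \<open>The preimage is read off from \<open>W_J_W\<close> at the vector
        \<open>J u\<close>, using \<open>J (J u) = u\<close>.\<close>
      show "u = W \<xi> (J (W (cnj \<xi>) (J u)))"
        using elim J_in[OF that] J_J[OF that] by simp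
      show "J (W (cnj \<xi>) (J u)) \<in> E n"
        by (intro J_in W_in that)
    qed
    then show ?case
      using W_lin W_norm W_in by (auto simp: hunitary_on_def)
  qed
  moreover have "AE \<xi> in \<mu> n. \<forall>v\<in>E n. \<forall>w\<in>E n. cinner (J (W \<xi> (J w))) v = cinner w (W (cnj \<xi>) v)"
    using mu.AE_cnj[OF W_J_W]
  proof eventually_elim
    case (elim \<xi>)
    have "cinner (J (W \<xi> (J w))) v = cinner w (W (cnj \<xi>) v)" if v: "v \<in> E n" and w: "w \<in> E n" for v w
    proof -
      \<comment> \<open>\<open>J (W \<xi> (J w))\<close> is a preimage of \<open>w\<close> under the
        isometry \<open>W (cnj \<xi>)\<close>. Applying that isometry to both arguments of the inner
        product therefore gives the adjoint relation.\<close>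
      have "W (cnj \<xi>) (J (W \<xi> (J w))) = w"
        using elim J_in[OF w] J_J[OF w] by simp
      then show ?thesis
        using W_inner[OF J_in[OF W_in[OF J_in[OF w]]] v, of "cnj \<xi>" \<xi>] by simp
    qed
    then show ?case
      by blast
  qed
  ultimately show ?thesis
    using rep by blast
qed

end

end

text \<open>The adjoint in (c) is expressed by an inner product identity, so no adjoint operator has
  to be constructed. Both (b) and (c) are compared with (a), by way of the equivalent form that
  \<open>C\<close> and \<open>U\<close> commute.\<close>

theorem theorem8p4:
  fixes U C :: "'h::chilbert \<Rightarrow> 'h"
    and \<mu> :: "nat \<Rightarrow> complex measure"
    and E :: "nat \<Rightarrow> 'e::chilbert set"
    and I :: "'h \<Rightarrow> nat \<Rightarrow> complex \<Rightarrow> 'e"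
  assumes sepH: "separable_H TYPE('h)"
    and U_unitary: "unitary_op U"
    and C_conj: "hconjugation C"
    and mu_borel: "\<And>n. circle_borel (\<mu> n)"
    and mu_finite: "\<And>n. finite_measure (\<mu> n)"
    and mu_sing: "\<And>m n. m \<noteq> n \<Longrightarrow> hmutually_singular (\<mu> m) (\<mu> n)"
    and E_sub: "\<And>n. hclosed_subspace (E n)"
    and E_dim: "\<And>n. hilbert_dim (E n) (dimidx n)"
    and I_iso: "isometric_iso \<mu> E I"
    and I_U: "\<And>x. aeqH \<mu> (I (U x)) (\<lambda>n. mult_xi (I x n))"
    and mu_ac: "\<And>n. absolutely_continuous (\<mu> n) (conj_measure (\<mu> n))"
  shows "((\<forall>x. C (U (C x)) = U x) \<longleftrightarrow>
          (\<exists>Cs. (\<forall>n. conjugation_L2 (\<mu> n) (E n) (Cs n)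
                    \<and> (\<forall>f. memL2 (\<mu> n) (E n) f \<longrightarrow>
                          (AE \<xi> in \<mu> n. Cs n (mult_xi (Cs n f)) \<xi> = mult_xi f \<xi>)))
               \<and> (\<forall>x. aeqH \<mu> (I (C x)) (\<lambda>n. Cs n (I x n)))))
       \<and> ((\<forall>x. C (U (C x)) = U x) \<longleftrightarrow>
          (\<forall>J. (\<forall>n. conjugation_on (E n) (J n)) \<longrightarrow>
             (\<exists>W. (\<forall>n. Linf_op (\<mu> n) (E n) (W n)
                     \<and> (AE \<xi> in \<mu> n. hunitary_on (E n) (W n \<xi>))
                     \<and> (AE \<xi> in \<mu> n. \<forall>v\<in>E n. \<forall>w\<in>E n.
                           cinner (J n (W n \<xi> (J n w))) v = cinner w (W n (cnj \<xi>) v)))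
                  \<and> (\<forall>x. aeqH \<mu> (I (C x))
                          (\<lambda>n \<xi>. W n \<xi> (Jsharp (\<mu> n) (J n) (I x n) \<xi>))))))"
proof -
  interpret spectral_rep U C \<mu> E I
    by (rule spectral_rep.intro) (fact assms)+
  let ?a = "\<forall>x. C (U (C x)) = U x"
  have "?a \<longleftrightarrow> (\<exists>Cs. (\<forall>n. conjugation_L2 (\<mu> n) (E n) (Cs n)
        \<and> (\<forall>f. memL2 (\<mu> n) (E n) f \<longrightarrow> (AE \<xi> in \<mu> n. Cs n (mult_xi (Cs n f)) \<xi> = mult_xi f \<xi>)))
      \<and> (\<forall>x. aeqH \<mu> (I (C x)) (\<lambda>n. Cs n (I x n))))" (is "_ \<longleftrightarrow> ?b")
  proof
    assume ?a
    then show ?b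
      using CUC_iff by (intro decomposes_if_commute) blast
  next
    assume ?b
    then obtain Cs where Cs: "\<And>n. conjugation_L2 (\<mu> n) (E n) (Cs n)"
      "\<And>n f. memL2 (\<mu> n) (E n) f \<Longrightarrow> AE \<xi> in \<mu> n. Cs n (mult_xi (Cs n f)) \<xi> = mult_xi f \<xi>"
      "\<And>x. aeqH \<mu> (I (C x)) (\<lambda>n. Cs n (I x n))"
      by blast
    show ?a
      by (intro allI commute_if_decomposes[OF Cs])
  qed
  moreover have "?a \<longleftrightarrow> (\<forall>J. (\<forall>n. conjugation_on (E n) (J n)) \<longrightarrow>
      (\<exists>W. (\<forall>n. Linf_op (\<mu> n) (E n) (W n)
          \<and> (AE \<xi> in \<mu> n. hunitary_on (E n) (W n \<xi>))
          \<and> (AE \<xi> in \<mu> n. \<forall>v\<in>E n. \<forall>w\<in>E n.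
                cinner (J n (W n \<xi> (J n w))) v = cinner w (W n (cnj \<xi>) v)))
        \<and> (\<forall>x. aeqH \<mu> (I (C x)) (\<lambda>n \<xi>. W n \<xi> (Jsharp (\<mu> n) (J n) (I x n) \<xi>)))))" (is "_ \<longleftrightarrow> ?c")
  proof
    assume ?a
    then have CU: "C (U x) = U (C x)" for x
      using CUC_iff by blast
    show ?c
    proof (intro allI impI)
      fix J assume J: "\<forall>n. conjugation_on (E n) (J n)"
      have "\<forall>n. \<exists>W. Linf_op (\<mu> n) (E n) W
          \<and> (AE \<xi> in \<mu> n. hunitary_on (E n) (W \<xi>))
          \<and> (AE \<xi> in \<mu> n. \<forall>v\<in>E n. \<forall>w\<in>E n. cinner (J n (W \<xi> (J n w))) v = cinner w (W (cnj \<xi>) v))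
          \<and> (\<forall>x. AE \<xi> in \<mu> n. I (C x) n \<xi> = W \<xi> (Jsharp (\<mu> n) (J n) (I x n) \<xi>))"
        using multiplication_if_commute[OF CU] J by blast
      then obtain W where "\<forall>n. Linf_op (\<mu> n) (E n) (W n)
          \<and> (AE \<xi> in \<mu> n. hunitary_on (E n) (W n \<xi>))
          \<and> (AE \<xi> in \<mu> n. \<forall>v\<in>E n. \<forall>w\<in>E n. cinner (J n (W n \<xi> (J n w))) v = cinner w (W n (cnj \<xi>) v))
          \<and> (\<forall>x. AE \<xi> in \<mu> n. I (C x) n \<xi> = W n \<xi> (Jsharp (\<mu> n) (J n) (I x n) \<xi>))"
        unfolding choice_iff by blast
      then show "\<exists>W. (\<forall>n. Linf_op (\<mu> n) (E n) (W n)
            \<and> (AE \<xi> in \<mu> n. hunitary_on (E n) (W n \<xi>))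
            \<and> (AE \<xi> in \<mu> n. \<forall>v\<in>E n. \<forall>w\<in>E n.
                  cinner (J n (W n \<xi> (J n w))) v = cinner w (W n (cnj \<xi>) v)))
          \<and> (\<forall>x. aeqH \<mu> (I (C x)) (\<lambda>n \<xi>. W n \<xi> (Jsharp (\<mu> n) (J n) (I x n) \<xi>)))"
        unfolding aeqH_def by (intro exI[of _ W]) simp
    qed
  next
    assume c: ?c
    \<comment> \<open>Instantiating (c) at one concrete family of conjugations rules out that it
      holds vacuously.\<close>
    have "\<exists>J. conjugation_on (E n) J" for n
      using ex_onb conjugation_on_exists[OF E_sub] by blast
    then obtain J where J: "\<And>n. conjugation_on (E n) (J n)"
      by metis
    then obtain W where "\<And>n. AE \<xi> in \<mu> n. hunitary_on (E n) (W n \<xi>)"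
      "\<And>x. aeqH \<mu> (I (C x)) (\<lambda>n \<xi>. W n \<xi> (Jsharp (\<mu> n) (J n) (I x n) \<xi>))"
      using c by blast
    from commute_if_multiplication[OF J this] show ?a
      by (simp add: C_C)
  qed
  ultimately show ?thesis
    by (rule conjI)
qed

end
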